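(* Let $\mathrm{N}\langle x_1,\ldots,x_n\rangle$ be the free Novikov algebra over a field $k$ of characteristic $0$ in the variables $x_1,\ldots,x_n$. If $f\in \mathrm{N}\langle x_1,\ldots,x_n\rangle$ and $f\notin \mathrm{N}\langle x_1,\ldots,x_{n-1}\rangle$, then $\mathrm{id}(f)\cap \mathrm{N}\langle x_1,\ldots,x_{n-1}\rangle=0$.
   Context: Algebras are $k$-vector spaces with a $k$-bilinear multiplication, not assumed associative or unital. A Novikov algebra is an algebra satisfying the identities $(xy)z-x(yz)=(xz)y-x(zy)$ and $x(yz)=y(xz)$. $\mathrm{N}\langle x_1,\ldots,x_n\rangle$ is the free (non-unital) algebra on $x_1,\ldots,x_n$ in the variety of Novikov algebras over $k$, and $\mathrm{N}\langle x_1,\ldots,x_{n-1}\rangle$ is regarded as its subalgebra generated by $x_1,\ldots,x_{n-1}$. $\mathrm{id}(f)$ denotes the (two-sided) ideal of $\mathrm{N}\langle x_1,\ldots,x_n\rangle$ generated by $f$. *)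

theory Defs
  imports Complex_Main
begin

section \<open>Algebras and Novikov algebras over a field\<close>

text \<open>The multiplication is an arbitrary bilinear map, neither associative nor unital.\<close>

locale nonassoc_algebra = vector_space scale
  for scale :: "'k::field \<Rightarrow> 'a::ab_group_add \<Rightarrow> 'a" +
  fixes mult :: "'a \<Rightarrow> 'a \<Rightarrow> 'a"
  assumes mult_add_left: "mult (a + b) c = mult a c + mult b c"
    and mult_add_right: "mult a (b + c) = mult a b + mult a c"
    and mult_scale_left: "mult (scale r a) b = scale r (mult a b)"
    and mult_scale_right: "mult a (scale r b) = scale r (mult a b)"
begin

definition subalgebra :: "'a set \<Rightarrow> bool" where
  "subalgebra S \<longleftrightarrow> subspace S \<and> (\<forall>a\<in>S. \<forall>b\<in>S. mult a b \<in> S)"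

definition two_sided_ideal :: "'a set \<Rightarrow> bool" where
  "two_sided_ideal I \<longleftrightarrow> subspace I \<and> (\<forall>a\<in>I. \<forall>b. mult a b \<in> I \<and> mult b a \<in> I)"

definition generated_subalgebra :: "'a set \<Rightarrow> 'a set" where
  "generated_subalgebra X = subalgebra hull X"

definition generated_ideal :: "'a set \<Rightarrow> 'a set" where
  "generated_ideal X = two_sided_ideal hull X"

end

locale novikov_algebra = nonassoc_algebra +
  assumes right_comm_assoc:
      "mult (mult a b) c - mult a (mult b c) = mult (mult a c) b - mult a (mult c b)"
    and left_comm: "mult a (mult b c) = mult b (mult a c)"


section \<open>The free Novikov algebra\<close>

text \<open>
  The free Novikov algebra over \<open>'k\<close> on the set of all elements of \<open>'v\<close> is the algebra of terms
  in the signature of algebras with generators from \<open>'v\<close>, modulo the least congruence containing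
  the vector space axioms, bilinearity of the product and the two Novikov identities. The negative
  of \<open>t\<close> is represented by \<open>Scale (-1) t\<close>.
\<close>

datatype ('v, 'k) nov_term =
    Var 'v
  | Zero
  | Add "('v, 'k) nov_term" "('v, 'k) nov_term"
  | Scale 'k "('v, 'k) nov_term"
  | Mult "('v, 'k) nov_term" "('v, 'k) nov_term"

abbreviation Diff :: "('v, 'k::field) nov_term \<Rightarrow> ('v, 'k) nov_term \<Rightarrow> ('v, 'k) nov_term" where
  "Diff s t \<equiv> Add s (Scale (-1) t)"

inductive nov_eq :: "('v, 'k::field) nov_term \<Rightarrow> ('v, 'k) nov_term \<Rightarrow> bool" where
  refl: "nov_eq s s"
| sym: "nov_eq s t \<Longrightarrow> nov_eq t s"
| trans: "nov_eq s t \<Longrightarrow> nov_eq t u \<Longrightarrow> nov_eq s u"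
| cong_Add: "nov_eq s s' \<Longrightarrow> nov_eq t t' \<Longrightarrow> nov_eq (Add s t) (Add s' t')"
| cong_Scale: "nov_eq s s' \<Longrightarrow> nov_eq (Scale r s) (Scale r s')"
| cong_Mult: "nov_eq s s' \<Longrightarrow> nov_eq t t' \<Longrightarrow> nov_eq (Mult s t) (Mult s' t')"
| Add_assoc: "nov_eq (Add (Add s t) u) (Add s (Add t u))"
| Add_comm: "nov_eq (Add s t) (Add t s)"
| Add_Zero: "nov_eq (Add Zero s) s"
| Scale_zero: "nov_eq (Scale 0 s) Zero"
| Scale_one: "nov_eq (Scale 1 s) s"
| Scale_Scale: "nov_eq (Scale r (Scale q s)) (Scale (r * q) s)"
| Scale_Add: "nov_eq (Scale r (Add s t)) (Add (Scale r s) (Scale r t))"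
| Scale_plus: "nov_eq (Scale (r + q) s) (Add (Scale r s) (Scale q s))"
| Mult_Add_left: "nov_eq (Mult (Add s t) u) (Add (Mult s u) (Mult t u))"
| Mult_Add_right: "nov_eq (Mult s (Add t u)) (Add (Mult s t) (Mult s u))"
| Mult_Scale_left: "nov_eq (Mult (Scale r s) t) (Scale r (Mult s t))"
| Mult_Scale_right: "nov_eq (Mult s (Scale r t)) (Scale r (Mult s t))"
| Right_comm_assoc:
    "nov_eq (Diff (Mult (Mult s t) u) (Mult s (Mult t u)))
            (Diff (Mult (Mult s u) t) (Mult s (Mult u t)))"
| Left_comm: "nov_eq (Mult s (Mult t u)) (Mult t (Mult s u))"

quotient_type (overloaded) ('v, 'k) free_novikov = "('v, 'k::field) nov_term" / nov_eq
  by (rule equivpI)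
     (auto intro!: reflpI sympI transpI intro: nov_eq.refl nov_eq.sym elim: nov_eq.trans)

instantiation free_novikov :: (type, field) ab_group_add
begin

lift_definition zero_free_novikov :: "('a, 'b) free_novikov" is Zero .

lift_definition plus_free_novikov ::
  "('a, 'b) free_novikov \<Rightarrow> ('a, 'b) free_novikov \<Rightarrow> ('a, 'b) free_novikov" is Add
  by (rule nov_eq.cong_Add)

lift_definition uminus_free_novikov :: "('a, 'b) free_novikov \<Rightarrow> ('a, 'b) free_novikov"
  is "Scale (-1)" by (rule nov_eq.cong_Scale)

lift_definition minus_free_novikov ::
  "('a, 'b) free_novikov \<Rightarrow> ('a, 'b) free_novikov \<Rightarrow> ('a, 'b) free_novikov" is Diff
  by (intro nov_eq.cong_Add nov_eq.cong_Scale)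

instance
proof
  fix a b c :: "('a, 'b) free_novikov"
  show "a + b + c = a + (b + c)" by transfer (rule nov_eq.Add_assoc)
  show "a + b = b + a" by transfer (rule nov_eq.Add_comm)
  show "0 + a = a" by transfer (rule nov_eq.Add_Zero)
  show "a - b = a + - b" by transfer (rule nov_eq.refl)
  show "- a + a = 0"
  proof transfer
    fix t :: "('a, 'b) nov_term"
    have "nov_eq (Add (Scale (-1) t) t) (Add (Scale (-1) t) (Scale 1 t))"
      by (intro nov_eq.cong_Add nov_eq.refl nov_eq.sym[OF nov_eq.Scale_one])
    moreover have "nov_eq (Add (Scale (-1) t) (Scale 1 t)) (Scale (-1 + 1) t)"
      by (rule nov_eq.sym[OF nov_eq.Scale_plus])
    moreover have "nov_eq (Scale (-1 + 1) t) Zero"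
      using nov_eq.Scale_zero[of t] by simp
    ultimately show "nov_eq (Add (Scale (-1) t) t) Zero"
      by (blast intro: nov_eq.trans)
  qed
qed

end

instantiation free_novikov :: (type, field) times
begin

lift_definition times_free_novikov ::
  "('a, 'b) free_novikov \<Rightarrow> ('a, 'b) free_novikov \<Rightarrow> ('a, 'b) free_novikov" is Mult
  by (rule nov_eq.cong_Mult)

instance ..

end

lift_definition nov_scale :: "'k::field \<Rightarrow> ('v, 'k) free_novikov \<Rightarrow> ('v, 'k) free_novikov"
  is Scale by (rule nov_eq.cong_Scale)

lift_definition nov_var :: "'v \<Rightarrow> ('v, 'k::field) free_novikov" is Var .

interpretation free_novikov:
  novikov_algebra "nov_scale :: 'k::field \<Rightarrow> ('v, 'k) free_novikov \<Rightarrow> _" "(*)"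
proof
  fix r q :: 'k and a b c :: "('v, 'k) free_novikov"
  show "nov_scale r (a + b) = nov_scale r a + nov_scale r b"
    by transfer (rule nov_eq.Scale_Add)
  show "nov_scale (r + q) a = nov_scale r a + nov_scale q a"
    by transfer (rule nov_eq.Scale_plus)
  show "nov_scale r (nov_scale q a) = nov_scale (r * q) a"
    by transfer (rule nov_eq.Scale_Scale)
  show "nov_scale 1 a = a" by transfer (rule nov_eq.Scale_one)
  show "(a + b) * c = a * c + b * c" by transfer (rule nov_eq.Mult_Add_left)
  show "a * (b + c) = a * b + a * c" by transfer (rule nov_eq.Mult_Add_right)
  show "nov_scale r a * b = nov_scale r (a * b)" by transfer (rule nov_eq.Mult_Scale_left)
  show "a * nov_scale r b = nov_scale r (a * b)" by transfer (rule nov_eq.Mult_Scale_right)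
  show "a * b * c - a * (b * c) = a * c * b - a * (c * b)"
    by transfer (rule nov_eq.Right_comm_assoc)
  show "a * (b * c) = b * (a * c)" by transfer (rule nov_eq.Left_comm)
qed


subsection \<open>The universal property\<close>

context novikov_algebra
begin

primrec eval_term :: "('v \<Rightarrow> 'b) \<Rightarrow> ('v, 'a) nov_term \<Rightarrow> 'b" where
  "eval_term h (Var v) = h v"
| "eval_term h Zero = 0"
| "eval_term h (Add s t) = eval_term h s + eval_term h t"
| "eval_term h (Scale r s) = scale r (eval_term h s)"
| "eval_term h (Mult s t) = mult (eval_term h s) (eval_term h t)"

lemma eval_term_nov_eq: "nov_eq s t \<Longrightarrow> eval_term h s = eval_term h t"
proof (induction rule: nov_eq.induct)
  case (Right_comm_assoc s t u)
  then show ?case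
    using right_comm_assoc[of "eval_term h s" "eval_term h t" "eval_term h u"]
    by simp
next
  case (Left_comm s t u)
  then show ?case by (simp add: left_comm)
qed (simp_all add: algebra_simps scale_right_distrib scale_left_distrib
       mult_add_left mult_add_right mult_scale_left mult_scale_right)

theorem free_novikov_universal:
  fixes h :: "'v \<Rightarrow> 'b"
  shows "\<exists>!\<phi>. Vector_Spaces.linear nov_scale scale \<phi> \<and>
           (\<forall>a b. \<phi> (a * b) = mult (\<phi> a) (\<phi> b)) \<and> (\<forall>v. \<phi> (nov_var v) = h v)"
proof -
  define \<phi> where "\<phi> a = eval_term h (rep_free_novikov a)" for a
  have \<phi>_abs: "\<phi> (abs_free_novikov t) = eval_term h t" for t
  proof -
    have "nov_eq t (rep_free_novikov (abs_free_novikov t))"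
      by (rule rep_abs_rsp[OF Quotient3_free_novikov nov_eq.refl])
    then show ?thesis unfolding \<phi>_def by (rule eval_term_nov_eq[symmetric])
  qed
  have "Vector_Spaces.linear nov_scale scale \<phi>"
  proof unfold_locales
    fix a b :: "('v, 'a) free_novikov" and r :: 'a
    show "\<phi> (a + b) = \<phi> a + \<phi> b"
      by (induction a rule: free_novikov.abs_induct, induction b rule: free_novikov.abs_induct)
         (simp add: plus_free_novikov.abs_eq \<phi>_abs)
    show "\<phi> (nov_scale r a) = scale r (\<phi> a)"
      by (induction a rule: free_novikov.abs_induct)
         (simp add: nov_scale.abs_eq \<phi>_abs)
  qed
  moreover have "\<phi> (a * b) = mult (\<phi> a) (\<phi> b)" for a b
    by (induction a rule: free_novikov.abs_induct, induction b rule: free_novikov.abs_induct)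
         (simp add: times_free_novikov.abs_eq \<phi>_abs)
  moreover have "\<phi> (nov_var v) = h v" for v
    by (simp add: nov_var.abs_eq \<phi>_abs)
  moreover have "\<psi> = \<phi>"
    if \<psi>: "Vector_Spaces.linear nov_scale scale \<psi>"
           "\<forall>a b. \<psi> (a * b) = mult (\<psi> a) (\<psi> b)" "\<forall>v. \<psi> (nov_var v) = h v" for \<psi>
  proof -
    interpret \<psi>: Vector_Spaces.linear nov_scale scale \<psi> by (rule \<psi>)
    have "\<psi> (abs_free_novikov t) = eval_term h t" for t
    proof (induction t)
      case (Var v)
      then show ?case using \<psi>(3) by (simp flip: nov_var.abs_eq)
    next
      case Zero
      then show ?case using \<psi>.zero by (simp flip: zero_free_novikov.abs_eq)
    next
      case (Add s t)
      then show ?case by (simp add: \<psi>.add flip: plus_free_novikov.abs_eq)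
    next
      case (Scale r t)
      then show ?case by (simp add: \<psi>.scale flip: nov_scale.abs_eq)
    next
      case (Mult s t)
      then show ?case using \<psi>(2) by (simp flip: times_free_novikov.abs_eq)
    qed
    then show ?thesis
      by (metis \<phi>_abs Quotient3_free_novikov Quotient3_abs_rep ext)
  qed
  ultimately show ?thesis by blast
qed

end

end

theory Submission
  imports Defs "HOL-Library.Multiset" "HOL-Library.Poly_Mapping" "HOL-Library.Countable_Set"
    "HOL-Computational_Algebra.Polynomial_Factorial" "HOL-Algebra.Algebraic_Closure_Type"
begin

text \<open>
  Over a commutative ring with a derivation, the product \<open>a' * b\<close> satisfies the Novikov
  identities. Sending \<open>x\<^sub>i\<close> to a differential indeterminate thus gives a homomorphism
  \<open>dpoly_of\<close> from the free Novikov algebra to the ring \<open>R\<close> of differential polynomials, and the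
  theorem becomes a statement about differential equations: if the image \<open>F\<close> of \<open>f\<close>
  involves \<open>y = x\<^sub>n\<close> or one of its derivatives, then \<open>F = 0\<close> can be solved for \<open>y\<close> with the
  other indeterminates in general position. The polynomials that vanish together with all their
  derivatives at such a solution form an ideal of \<open>R\<close> closed under the derivation; its preimage is
  an ideal that contains \<open>f\<close>, and a nonzero polynomial in the other indeterminates does not vanish
  at a point in general position.

  For this reduction \<open>dpoly_of\<close> must be injective, and it must detect membership in the subalgebra
  generated by some of the variables (\<open>generated_subalgebra_iff\<close>). Both follow from a
  left inverse. Images of \<open>dpoly_of\<close> are linear combinations of balanced monomials, the products
  of \<open>m\<close> letters (derivatives of indeterminates) whose orders have the sum \<open>m - 1\<close>. For every
  Novikov algebra \<open>A\<close> and every choice of values in \<open>A\<close> for the indeterminates, a balanced monomial has a value in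
  \<open>A\<close>, and this evaluation turns \<open>p' * q\<close> into the product of the values
  (\<open>monomial_value_mult\<close>). To define the value, left multiplication by \<open>a\<close> is read as
  multiplication by \<open>a'\<close>. Left multiplications commute, by the identity
  \<open>a (b c) = b (a c)\<close>, and a factor \<open>a\<^sup>(\<^sup>k\<^sup>)\<close> acts as a symmetric operation with \<open>k\<close> arguments that
  is defined by recursion on \<open>k\<close>; the other Novikov identity makes it symmetric
  (\<open>deriv_form_swap\<close>). A balanced monomial is the composition of the operations of its
  differentiated letters, applied to its undifferentiated letters.

  For the differential equation, let \<open>r\<close> be the order of \<open>F\<close> in \<open>y\<close>, and let all
  letters except the derivatives of \<open>y\<close> of order at least \<open>r\<close> take values in an algebraically closed
  field that are algebraically independent over \<open>k\<close>. Let \<open>y\<^sup>(\<^sup>r\<^sup>)\<close> take the value \<open>\<alpha>\<close>, a root of \<open>F\<close>, and let \<open>P\<close> be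
  a polynomial of least degree in \<open>y\<^sup>(\<^sup>r\<^sup>)\<close> with root \<open>\<alpha>\<close>, whose coefficients involve
  only those letters. In characteristic \<open>0\<close> the partial derivative
  of \<open>P\<close> with respect to \<open>y\<^sup>(\<^sup>r\<^sup>)\<close> does not vanish at \<open>\<alpha>\<close>, by minimality. It is the coefficient of
  \<open>y\<^sup>(\<^sup>r\<^sup>+\<^sup>j\<^sup>)\<close> in the \<open>j\<close>-th derivative of \<open>P\<close>, so these derivatives can be made to vanish one after
  the other by choosing the values of \<open>y\<^sup>(\<^sup>r\<^sup>+\<^sup>1\<^sup>), y\<^sup>(\<^sup>r\<^sup>+\<^sup>2\<^sup>), \<dots>\<close>. Finally \<open>P\<close> divides \<open>d * F\<close> for some \<open>d\<close> that
  does not vanish at the point, so the derivatives of \<open>F\<close> vanish there as well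
  (\<open>generic_zero\<close>).
\<close>

section \<open>Differential polynomials\<close>

abbreviation keys :: "('m \<Rightarrow>\<^sub>0 'c::zero) \<Rightarrow> 'm set" where
  "keys \<equiv> Poly_Mapping.keys"

abbreviation lookup :: "('m \<Rightarrow>\<^sub>0 'c::zero) \<Rightarrow> 'm \<Rightarrow> 'c" where
  "lookup \<equiv> Poly_Mapping.lookup"

abbreviation single :: "'m \<Rightarrow> 'c \<Rightarrow> 'm \<Rightarrow>\<^sub>0 'c::zero" where
  "single \<equiv> Poly_Mapping.single"

definition linear_ext :: "('m \<Rightarrow> 'c \<Rightarrow> 'd::comm_monoid_add) \<Rightarrow> ('m \<Rightarrow>\<^sub>0 'c::zero) \<Rightarrow> 'd" where
  "linear_ext g p = (\<Sum>m\<in>keys p. g m (lookup p m))"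

text \<open>
  The families \<open>g\<close> for which \<open>linear_ext g\<close> is additive. The coefficient is an argument of
  \<open>g\<close>, so that derivation, evaluation in a field and evaluation in a Novikov algebra, which
  scale their values in different ways, are instances of one construction.
\<close>

definition additive_family :: "('m \<Rightarrow> 'c::comm_monoid_add \<Rightarrow> 'd::comm_monoid_add) \<Rightarrow> bool" where
  "additive_family g \<longleftrightarrow> (\<forall>m. g m 0 = 0)
     \<and> (\<forall>m a b. g m (a + b) = g m a + g m b)"

lemma linear_ext_add:
  "additive_family g \<Longrightarrow> linear_ext g (p + q) = linear_ext g p + linear_ext g q"
  unfolding linear_ext_def additive_family_def by (rule setsum_keys_plus_distrib) auto

lemma linear_ext_single: "additive_family g \<Longrightarrow> linear_ext g (single m c) = g m c"
  by (cases "c = 0") (simp_all add: linear_ext_def additive_family_def)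

lemma linear_ext_zero: "linear_ext g 0 = 0"
  by (simp add: linear_ext_def)

lemma linear_ext_sum: "additive_family g \<Longrightarrow> linear_ext g (\<Sum>i\<in>I. p i) = (\<Sum>i\<in>I. linear_ext g (p i))"
  by (induction I rule: infinite_finite_induct) (simp_all add: linear_ext_zero linear_ext_add)

lemma linear_ext_sum_mset: "additive_family g \<Longrightarrow> linear_ext g (\<Sum>i\<in>#I. p i) = (\<Sum>i\<in>#I. linear_ext g (p i))"
  by (induction I) (simp_all add: linear_ext_zero linear_ext_add)

lemma sum_singles:
  fixes p :: "'m \<Rightarrow>\<^sub>0 'c::comm_monoid_add"
  shows "(\<Sum>m\<in>keys p. single m (lookup p m)) = p"
proof (rule poly_mapping_eqI)
  fix k
  have "lookup (\<Sum>m\<in>keys p. single m (lookup p m)) k = (\<Sum>m\<in>keys p. if m = k then lookup p m else 0)"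
    unfolding lookup_sum by (intro sum.cong) (simp_all add: lookup_single when_def)
  then show "lookup (\<Sum>m\<in>keys p. single m (lookup p m)) k = lookup p k"
    by (simp add: in_keys_iff)
qed

lemma poly_mapping_add_induct [case_names single add]:
  fixes p :: "'m \<Rightarrow>\<^sub>0 'c::comm_monoid_add"
  assumes single: "\<And>m c. P (single m c)" and add: "\<And>p q. P p \<Longrightarrow> P q \<Longrightarrow> P (p + q)"
  shows "P p"
proof -
  have "P (\<Sum>m\<in>K. single m (lookup p m))" for K
  proof (induction K rule: infinite_finite_induct)
    case empty
    then show ?case using single[of undefined 0] by simp
  qed (use single[of undefined 0] in \<open>simp_all add: single add\<close>)
  from this[of "keys p"] show ?thesis by (simp add: sum_singles)
qed

text \<open>
  The letter \<open>(v, k)\<close> stands for the \<open>k\<close>-th derivative of the indeterminate \<open>v\<close>; a monomial is a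
  finite multiset of letters.
\<close>

type_synonym ('v, 'k) dpoly = "('v \<times> nat) multiset \<Rightarrow>\<^sub>0 'k"

definition raise :: "'v \<times> nat \<Rightarrow> ('v \<times> nat) multiset \<Rightarrow> ('v \<times> nat) multiset" where
  "raise l m = add_mset (apsnd Suc l) (m - {#l#})"

definition ddt :: "('v, 'k::comm_ring_1) dpoly \<Rightarrow> ('v, 'k) dpoly" where
  "ddt = linear_ext (\<lambda>m c. \<Sum>l\<in>#m. single (raise l m) c)"

lemma additive_ddt:
  "additive_family (\<lambda>m c. \<Sum>l\<in>#m. single (raise l m) (c::'k::comm_ring_1))"
  by (simp add: additive_family_def single_add sum_mset.distrib)

lemma ddt_add: "ddt (p + q) = ddt p + ddt q"
  unfolding ddt_def by (rule linear_ext_add[OF additive_ddt])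

lemma ddt_zero [simp]: "ddt 0 = 0"
  unfolding ddt_def by (rule linear_ext_zero)

lemma ddt_sum: "ddt (\<Sum>i\<in>I. p i) = (\<Sum>i\<in>I. ddt (p i))"
  unfolding ddt_def by (rule linear_ext_sum[OF additive_ddt])

lemma ddt_single: "ddt (single m c) = (\<Sum>l\<in>#m. single (raise l m) c)"
  unfolding ddt_def by (rule linear_ext_single[OF additive_ddt])

lemma ddt_mult: "ddt (p * q) = ddt p * q + p * ddt q"
proof (induction p rule: poly_mapping_add_induct)
  case (add p p')
  then show ?case by (simp add: ddt_add algebra_simps)
next
  case (single m a)
  show ?case
  proof (induction q rule: poly_mapping_add_induct)
    case (add q q')
    then show ?case by (simp add: ddt_add algebra_simps)
  next
    case (single n b)
    have l: "(\<Sum>l\<in>#m. single (raise l (m + n)) (a * b)) = (\<Sum>l\<in>#m. single (raise l m) a * single n b)"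
      by (intro arg_cong[of _ _ sum_mset] image_mset_cong) (simp add: mult_single raise_def)
    have r: "(\<Sum>l\<in>#n. single (raise l (m + n)) (a * b)) = (\<Sum>l\<in>#n. single m a * single (raise l n) b)"
      by (intro arg_cong[of _ _ sum_mset] image_mset_cong) (simp add: mult_single raise_def)
    have "ddt (single m a * single n b) = (\<Sum>l\<in>#m. single (raise l (m + n)) (a * b))
        + (\<Sum>l\<in>#n. single (raise l (m + n)) (a * b))"
      by (simp add: mult_single ddt_single)
    also have "\<dots> = ddt (single m a) * single n b + single m a * ddt (single n b)"
      unfolding l r by (simp add: ddt_single sum_mset_distrib_left sum_mset_distrib_right)
    finally show ?case .
  qed
qed

lemma ddt_const: "ddt (single 0 c) = 0"
  using ddt_single[of 0 c] by simp

abbreviation letter :: "'v \<times> nat \<Rightarrow> ('v, 'k::comm_ring_1) dpoly" where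
  "letter l \<equiv> single {#l#} 1"

lemma ddt_letter: "ddt (letter l) = letter (apsnd Suc l)"
  by (simp add: ddt_single raise_def)

definition letters :: "('v, 'k::zero) dpoly \<Rightarrow> ('v \<times> nat) set" where
  "letters p = (\<Union>m\<in>keys p. set_mset m)"

lemma letters_add: "letters (p + q) \<subseteq> letters p \<union> letters q"
  using keys_add[of p q] unfolding letters_def by blast

lemma letters_mult: "letters (p * q) \<subseteq> letters p \<union> letters q"
proof
  fix l assume "l \<in> letters (p * q)"
  then obtain m where m: "m \<in> keys (p * q)" "l \<in># m" by (auto simp: letters_def)
  from m(1) keys_mult[of p q] obtain a b where "m = a + b" "a \<in> keys p" "b \<in> keys q" by blast
  with m(2) show "l \<in> letters p \<union> letters q" by (auto simp: letters_def)
qed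

lemma letters_single: "letters (single m c) \<subseteq> set_mset m"
  by (simp add: letters_def)

lemma letters_zero [simp]: "letters 0 = {}"
  by (simp add: letters_def)

lemma letters_sum: "(\<And>i. i \<in> I \<Longrightarrow> letters (p i) \<subseteq> A) \<Longrightarrow> letters (\<Sum>i\<in>I. p i) \<subseteq> A"
proof (induction I rule: infinite_finite_induct)
  case (insert i I)
  then show ?case using letters_add[of "p i" "\<Sum>i\<in>I. p i"] by auto
qed simp_all

lemma letters_sum_mset: "(\<And>i. i \<in># I \<Longrightarrow> letters (p i) \<subseteq> A) \<Longrightarrow> letters (\<Sum>i\<in>#I. p i) \<subseteq> A"
proof (induction I)
  case (add i I)
  then show ?case using letters_add[of "p i" "\<Sum>i\<in>#I. p i"] by auto
qed simp_all

lemma letters_diff: "letters (p - q) \<subseteq> letters p \<union> letters (q :: ('v, 'k::comm_ring_1) dpoly)"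
proof -
  have "keys (p - q) \<subseteq> keys p \<union> keys q" by (auto simp: in_keys_iff lookup_minus)
  then show ?thesis unfolding letters_def by blast
qed

lemma letters_ddt: "letters (ddt p) \<subseteq> letters p \<union> apsnd Suc ` letters p"
proof -
  have "letters (\<Sum>l\<in>#m. single (raise l m) (lookup p m)) \<subseteq> letters p \<union> apsnd Suc ` letters p"
    if "m \<in> keys p" for m
  proof (rule letters_sum_mset)
    fix l assume l: "l \<in># m"
    have "set_mset (raise l m) \<subseteq> set_mset m \<union> apsnd Suc ` set_mset m"
      using l by (auto simp: raise_def dest: in_diffD)
    moreover have "set_mset m \<subseteq> letters p" using that by (auto simp: letters_def)
    ultimately show "letters (single (raise l m) (lookup p m)) \<subseteq> letters p \<union> apsnd Suc ` letters p"
      using letters_single[of "raise l m" "lookup p m"] by blast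
  qed
  then show ?thesis unfolding ddt_def linear_ext_def by (rule letters_sum)
qed

lemma letters_power: "letters (p ^ n) \<subseteq> letters (p :: ('v, 'k::comm_ring_1) dpoly)"
proof (induction n)
  case 0
  show ?case by (simp add: letters_def)
next
  case (Suc n)
  then show ?case using letters_mult[of p "p ^ n"] by auto
qed

lemma letters_poly:
  fixes P :: "('v, 'k::comm_ring_1) dpoly poly"
  assumes "\<And>i. letters (coeff P i) \<subseteq> A" "letters x \<subseteq> A"
  shows "letters (poly P x) \<subseteq> A"
  unfolding poly_altdef
proof (rule letters_sum)
  fix i
  show "letters (coeff P i * x ^ i) \<subseteq> A"
    using letters_mult[of "coeff P i" "x ^ i"] letters_power[of x i] assms by blast
qed

text \<open>
  A single letter can be treated as the variable of a univariate polynomial. Degrees, roots and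
  division with respect to this letter then have their usual meaning.
\<close>

lemma collect_letter:
  fixes p :: "('v, 'k::comm_ring_1) dpoly"
  obtains P where "p = poly P (letter l)" "\<And>i. letters (coeff P i) \<subseteq> letters p - {l}"
proof -
  have monomial: "\<exists>P. single m c = poly P (letter l) \<and> (\<forall>i. letters (coeff P i) \<subseteq> set_mset m - {l})"
    for m and c :: 'k
  proof (intro exI conjI allI)
    let ?P = "Polynomial.monom (single (filter_mset (\<lambda>x. x \<noteq> l) m) c) (count m l)"
    have "letter l ^ n = single (replicate_mset n l) (1::'k)" for n
    proof (induction n)
      case 0
      then show ?case by simp
    qed (simp add: mult_single)
    moreover have "filter_mset (\<lambda>x. x \<noteq> l) m + replicate_mset (count m l) l = m"
      by (rule multiset_eqI) simp
    ultimately show "single m c = poly ?P (letter l)"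
      by (simp add: poly_monom mult_single)
    show "letters (coeff ?P i) \<subseteq> set_mset m - {l}" for i
      using letters_single[of "filter_mset (\<lambda>x. x \<noteq> l) m" c] by (auto simp: coeff_monom)
  qed
  have "\<exists>P. (\<Sum>m\<in>K. single m (lookup p m)) = poly P (letter l) \<and> (\<forall>i. letters (coeff P i) \<subseteq> letters p - {l})"
    if "K \<subseteq> keys p" for K
    using finite_subset[OF that finite_keys] that
  proof (induction K)
    case empty
    then show ?case by (intro exI[of _ 0]) simp
  next
    case (insert m K)
    then obtain P where P: "(\<Sum>m\<in>K. single m (lookup p m)) = poly P (letter l)"
      "\<And>i. letters (coeff P i) \<subseteq> letters p - {l}" by auto
    from monomial obtain Q where Q: "single m (lookup p m) = poly Q (letter l)"
      "\<And>i. letters (coeff Q i) \<subseteq> set_mset m - {l}" by metis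
    have m: "set_mset m \<subseteq> letters p" using insert.prems by (auto simp: letters_def)
    have "letters (coeff (Q + P) i) \<subseteq> letters p - {l}" for i
      using letters_add[of "coeff Q i" "coeff P i"] P(2)[of i] Q(2)[of i] m by auto
    moreover have "(\<Sum>m\<in>insert m K. single m (lookup p m)) = poly (Q + P) (letter l)"
      using insert.hyps P(1) Q(1) by simp
    ultimately show ?case by blast
  qed
  from this[of "keys p"] show ?thesis using that by (auto simp: sum_singles)
qed


section \<open>Operations on a Novikov algebra\<close>

context novikov_algebra
begin

notation mult (infixl "\<cdot>" 70)

text \<open>
  The algebra of operators generated by the left multiplications. If the product is
  \<open>a' * b\<close>, then its elements are the multiplications by certain elements of a commutative ring.
  The lemmas below prove in an arbitrary Novikov algebra what this picture suggests: the operators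
  commute, and they have a derivative.
\<close>

inductive_set mult_ops :: "('b \<Rightarrow> 'b) set" where
  ident: "(\<lambda>a. a) \<in> mult_ops"
| left: "(\<lambda>a. b \<cdot> a) \<in> mult_ops"
| diff: "r \<in> mult_ops \<Longrightarrow> s \<in> mult_ops \<Longrightarrow> (\<lambda>a. r a - s a) \<in> mult_ops"
| comp: "r \<in> mult_ops \<Longrightarrow> s \<in> mult_ops \<Longrightarrow> (\<lambda>a. r (s a)) \<in> mult_ops"

lemma mult_diff_left: "(a - b) \<cdot> c = a \<cdot> c - b \<cdot> c"
  using mult_add_left[of "a - b" b c] by (simp add: algebra_simps)

lemma mult_diff_right: "a \<cdot> (b - c) = a \<cdot> b - a \<cdot> c"
  using mult_add_right[of a "b - c" c] by (simp add: algebra_simps)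

lemma mult_ops_diff:
  "r \<in> mult_ops \<Longrightarrow> r (a - b) = r a - r b"
  by (induction arbitrary: a b rule: mult_ops.induct) (simp_all add: mult_diff_right)

lemma mult_ops_zero: "r \<in> mult_ops \<Longrightarrow> r 0 = 0"
  using mult_ops_diff[of r 0 0] by simp

lemma mult_ops_add:
  assumes "r \<in> mult_ops"
  shows "r (a + b) = r a + r b"
proof -
  have "r (a - (0 - b)) = r a - (r 0 - r b)"
    by (simp only: mult_ops_diff[OF assms])
  then show ?thesis by (simp add: mult_ops_zero[OF assms])
qed

lemma mult_ops_sum_mset:
  "r \<in> mult_ops \<Longrightarrow> r (\<Sum>x\<in>#M. f x) = (\<Sum>x\<in>#M. r (f x))"
  by (induction M) (simp_all add: mult_ops_zero mult_ops_add)

lemma zero_mult_op: "(\<lambda>a. 0) \<in> mult_ops"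
  using mult_ops.diff[OF mult_ops.ident mult_ops.ident] by simp

lemma sum_mult_op:
  assumes "\<And>x. x \<in># M \<Longrightarrow> r x \<in> mult_ops"
  shows "(\<lambda>a. \<Sum>x\<in>#M. r x a) \<in> mult_ops"
  using assms
proof (induction M)
  case empty
  then show ?case using zero_mult_op by simp
next
  case (add y M)
  then have "(\<lambda>a. r y a - (0 - (\<Sum>x\<in>#M. r x a))) \<in> mult_ops"
    by (intro mult_ops.diff zero_mult_op) auto
  then show ?case by (simp add: add.commute)
qed

lemma mult_ops_left: "r \<in> mult_ops \<Longrightarrow> r (b \<cdot> a) = b \<cdot> r a"
  by (induction arbitrary: a rule: mult_ops.induct)
     (simp_all add: mult_diff_right left_comm)

lemma mult_ops_commute:
  "r \<in> mult_ops \<Longrightarrow> s \<in> mult_ops \<Longrightarrow> r (s a) = s (r a)"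
  by (induction arbitrary: a rule: mult_ops.induct)
     (simp_all add: mult_ops_diff mult_ops_left)

text \<open>
  If \<open>r\<close> is multiplication by a ring element, then \<open>r a \<cdot> c - r (a \<cdot> c)\<close> is
  \<open>(r * a)' * c - r * a' * c = r' * a * c\<close>, which is symmetric in \<open>a\<close> and \<open>c\<close>. For a left
  multiplication this is the right-commutativity of the associator.
\<close>

lemma mult_ops_swap:
  "r \<in> mult_ops \<Longrightarrow> r a \<cdot> c - r (a \<cdot> c) = r c \<cdot> a - r (c \<cdot> a)"
proof (induction arbitrary: a c rule: mult_ops.induct)
  case ident
  then show ?case by simp
next
  case (left b)
  then show ?case using right_comm_assoc[of b a c] by simp
next
  case (diff r s)
  have expand: "(r a - s a) \<cdot> c - (r (a \<cdot> c) - s (a \<cdot> c))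
      = (r a \<cdot> c - r (a \<cdot> c)) - (s a \<cdot> c - s (a \<cdot> c))" for a c
    by (simp add: mult_diff_left algebra_simps)
  show ?case
    unfolding expand diff.IH(1)[of a c] diff.IH(2)[of a c] ..
next
  case (comp r s)
  \<comment> \<open>the Leibniz rule \<open>(r * s)' = r * s' + s * r'\<close>\<close>
  have expand: "r (s a) \<cdot> c - r (s (a \<cdot> c))
      = r (s a \<cdot> c - s (a \<cdot> c)) + s (r c \<cdot> a - r (c \<cdot> a))" for a c
  proof -
    have "r (s a) \<cdot> c - r (s a \<cdot> c) = s (r c \<cdot> a) - s (r (c \<cdot> a))"
      using comp.IH(1)[of "s a" c] comp.hyps
      by (simp add: mult_ops_left[of s, symmetric] mult_ops_commute[of r s])
    then show ?thesis using comp.hyps by (simp add: mult_ops_diff algebra_simps)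
  qed
  show ?case
    unfolding expand comp.IH(2)[of a c] comp.IH(1)[of a c] ..
qed

text \<open>
  A form of weight \<open>w\<close> is an operation on multisets of \<open>w + 1\<close> arguments that acts on each argument,
  the others being fixed, through an operator in \<open>mult_ops\<close>. In the differential picture it is
  \<open>a\<^sub>0, \<dots>, a\<^sub>w \<mapsto> g * a\<^sub>0 * \<dots> * a\<^sub>w\<close> for some \<open>g\<close>. Its values on multisets of other sizes
  are arbitrary.
\<close>

definition form :: "nat \<Rightarrow> ('b multiset \<Rightarrow> 'b) \<Rightarrow> bool" where
  "form w \<Lambda> \<longleftrightarrow> (\<forall>M. size M = w \<longrightarrow> (\<lambda>a. \<Lambda> (add_mset a M)) \<in> mult_ops)"

lemma formD: "form w \<Lambda> \<Longrightarrow> size M = w \<Longrightarrow> (\<lambda>a. \<Lambda> (add_mset a M)) \<in> mult_ops"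
  by (simp add: form_def)

text \<open>
  If \<open>\<Lambda>\<close> multiplies its arguments by \<open>g\<close>, then \<open>deriv_form \<Lambda>\<close> multiplies its arguments by \<open>g'\<close>:
  the formula solves the Leibniz rule for
  \<open>\<Lambda> (N) \<cdot> c = (g * \<Prod>N)' * c\<close>. It singles out one argument \<open>c\<close>, chosen arbitrarily.
\<close>

definition deriv_form :: "('b multiset \<Rightarrow> 'b) \<Rightarrow> 'b multiset \<Rightarrow> 'b" where
  "deriv_form \<Lambda> M = (let c = (SOME c. c \<in># M); N = M - {#c#}
     in \<Lambda> N \<cdot> c - (\<Sum>a\<in>#N. \<Lambda> (add_mset (a \<cdot> c) (N - {#a#}))))"

text \<open>
  The formula for \<open>deriv_form\<close> gives the same value for any choice of the distinguished argument.
  Since the operators commute with left multiplications, the sums over the remaining arguments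
  agree; what is left is \<open>mult_ops_swap\<close>.
\<close>

lemma deriv_form_swap:
  assumes \<Lambda>: "form w \<Lambda>" and N: "size N = w"
  shows "\<Lambda> (add_mset b N) \<cdot> c - (\<Sum>a\<in>#add_mset b N. \<Lambda> (add_mset (a \<cdot> c) (add_mset b N - {#a#})))
       = \<Lambda> (add_mset c N) \<cdot> b - (\<Sum>a\<in>#add_mset c N. \<Lambda> (add_mset (a \<cdot> b) (add_mset c N - {#a#})))"
proof -
  have step: "(\<Sum>a\<in>#N. \<Lambda> (add_mset (a \<cdot> c) (add_mset b N - {#a#})))
      = (\<Sum>a\<in>#N. a \<cdot> \<Lambda> (add_mset b (add_mset c (N - {#a#}))))" for b c
  proof (intro arg_cong[of _ _ sum_mset] image_mset_cong)
    fix a assume "a \<in># N"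
    then have eq: "add_mset b N - {#a#} = add_mset b (N - {#a#})"
      and "size (add_mset b (N - {#a#})) = w"
      using N by (auto simp: multiset_add_sub_el_shuffle size_Suc_Diff1)
    then have "(\<lambda>x. \<Lambda> (add_mset x (add_mset b (N - {#a#})))) \<in> mult_ops"
      by (intro formD[OF \<Lambda>])
    from mult_ops_left[OF this] show "\<Lambda> (add_mset (a \<cdot> c) (add_mset b N - {#a#}))
        = a \<cdot> \<Lambda> (add_mset b (add_mset c (N - {#a#})))"
      by (simp add: eq add_mset_commute)
  qed
  show ?thesis
    using mult_ops_swap[OF formD[OF \<Lambda> N], of b c]
    by (simp add: step add_mset_commute algebra_simps)
qed

lemma deriv_form_add_mset:
  assumes \<Lambda>: "form w \<Lambda>" and N: "size N = Suc w"
  shows "deriv_form \<Lambda> (add_mset c N) = \<Lambda> N \<cdot> c - (\<Sum>a\<in>#N. \<Lambda> (add_mset (a \<cdot> c) (N - {#a#})))"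
proof -
  define c' where "c' = (SOME c'. c' \<in># add_mset c N)"
  have c': "c' \<in># add_mset c N"
    unfolding c'_def by (rule someI[of _ c]) simp
  have eq: "deriv_form \<Lambda> (add_mset c N) = (let N = add_mset c N - {#c'#}
     in \<Lambda> N \<cdot> c' - (\<Sum>a\<in>#N. \<Lambda> (add_mset (a \<cdot> c') (N - {#a#}))))"
    unfolding deriv_form_def c'_def Let_def ..
  show ?thesis
  proof (cases "c' = c")
    case True
    then show ?thesis by (simp add: eq Let_def)
  next
    case False
    with c' have "c' \<in># N" by simp
    then obtain B where B: "N = add_mset c' B" by (metis multi_member_split)
    with N have "size B = w" by simp
    from deriv_form_swap[OF \<Lambda> this, of c c'] show ?thesis
      using False by (simp add: eq[unfolded B] Let_def B add_mset_commute)
  qed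
qed

lemma form_deriv_form:
  assumes \<Lambda>: "form w \<Lambda>"
  shows "form (Suc w) (deriv_form \<Lambda>)"
  unfolding form_def
proof (intro allI impI)
  fix M :: "'b multiset" assume M: "size M = Suc w"
  have "(\<lambda>c. \<Lambda> M \<cdot> c - (\<Sum>a\<in>#M. \<Lambda> (add_mset (a \<cdot> c) (M - {#a#})))) \<in> mult_ops"
  proof (intro mult_ops.diff mult_ops.left sum_mult_op)
    fix a assume "a \<in># M"
    with M have "size (M - {#a#}) = w" by (simp add: size_Diff_singleton)
    from mult_ops.comp[OF formD[OF \<Lambda> this] mult_ops.left]
    show "(\<lambda>c. \<Lambda> (add_mset (a \<cdot> c) (M - {#a#}))) \<in> mult_ops" .
  qed
  then show "(\<lambda>c. deriv_form \<Lambda> (add_mset c M)) \<in> mult_ops"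
    by (simp add: deriv_form_add_mset[OF \<Lambda> M])
qed

text \<open>
  The product of two multiplication forms substitutes the value of one for an argument of the other.
  Which arguments go to the inner form is chosen arbitrarily.
\<close>

definition prod_form :: "nat \<Rightarrow> ('b multiset \<Rightarrow> 'b) \<Rightarrow> ('b multiset \<Rightarrow> 'b) \<Rightarrow> 'b multiset \<Rightarrow> 'b" where
  "prod_form v P \<Lambda> M = (let N = (SOME N. N \<subseteq># M \<and> size N = Suc v) in P (add_mset (\<Lambda> N) (M - N)))"

text \<open>
  An argument of the inner form can be exchanged with one of the outer form, because the operators
  by which the two forms act on these arguments commute.
\<close>

lemma prod_form_exchange:
  assumes P: "form (Suc u) P" and \<Lambda>: "form v \<Lambda>" and B: "size B = v" and C: "size C = u"
  shows "P (add_mset (\<Lambda> (add_mset b B)) (add_mset a C)) = P (add_mset (\<Lambda> (add_mset a B)) (add_mset b C))"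
proof -
  define r where "r = (\<lambda>x. \<Lambda> (add_mset x B))"
  have r: "r \<in> mult_ops" unfolding r_def by (rule formD[OF \<Lambda> B])
  have q: "(\<lambda>x. P (add_mset x (add_mset a C))) \<in> mult_ops" for a
    by (rule formD[OF P]) (simp add: C)
  have "P (add_mset (r b) (add_mset a C)) = r (P (add_mset b (add_mset a C)))"
    by (rule mult_ops_commute[OF q r])
  also have "\<dots> = r (P (add_mset a (add_mset b C)))"
    by (simp add: add_mset_commute)
  also have "\<dots> = P (add_mset (r a) (add_mset b C))"
    by (rule mult_ops_commute[OF r q])
  finally show ?thesis by (simp add: r_def)
qed

text \<open>
  Any two choices of the inner arguments are connected by a sequence of exchanges, each of which brings
  the first choice closer to the second.
\<close>

lemma prod_form_indep:
  assumes P: "form u P" and \<Lambda>: "form v \<Lambda>"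
    and "size N = Suc v" "size A = u" "size N' = Suc v" "N + A = N' + A'"
  shows "P (add_mset (\<Lambda> N) A) = P (add_mset (\<Lambda> N') A')"
  using assms(3-)
proof (induction "size (N - N')" arbitrary: N A)
  case 0
  then have "N - N' = {#}" by simp
  then have "N \<subseteq># N'" by (simp add: Diff_eq_empty_iff_mset)
  then have "N = N'" using 0 by (metis mset_subset_size order.irrefl subset_mset.le_neq_trans)
  with 0 show ?case by simp
next
  case (Suc s)
  then obtain b where b: "b \<in># N - N'"
    by (metis multiset_nonemptyE size_empty nat.distinct(1))
  have "\<not> N' \<subseteq># N"
    using Suc.prems(1,3) b
    by (metis Diff_eq_empty_iff_mset empty_iff mset_subset_size nat_neq_iff set_mset_empty subset_mset.le_neq_trans)
  then obtain a where a: "a \<in># N' - N"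
    by (metis Diff_eq_empty_iff_mset multiset_nonemptyE)
  have "a \<noteq> b" using a b by (auto simp: in_diff_count)
  from b obtain B where B: "N = add_mset b B" by (metis in_diffD multi_member_split)
  have "count N' a \<le> count N a + count A a"
    using arg_cong[OF Suc.prems(4), of "\<lambda>M. count M a"] by simp
  moreover have "count N a < count N' a" using a by (simp add: in_diff_count)
  ultimately have "0 < count A a" by linarith
  then have "a \<in># A" by (simp only: count_greater_zero_iff)
  then obtain C where C: "A = add_mset a C" by (metis multi_member_split)
  have sizes: "size B = v" "Suc (size C) = u" using Suc.prems(1,2) B C by auto
  have "N - N' = add_mset b (add_mset a B - N')"
    using a b \<open>a \<noteq> b\<close> unfolding B
    by (intro multiset_eqI) (auto simp: in_diff_count)
  then have s: "s = size (add_mset a B - N')" using Suc.hyps(2) by simp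
  have "P (add_mset (\<Lambda> (add_mset b B)) (add_mset a C)) = P (add_mset (\<Lambda> (add_mset a B)) (add_mset b C))"
    by (rule prod_form_exchange[OF _ \<Lambda> sizes(1)]) (simp_all add: sizes(2) P)
  also have "\<dots> = P (add_mset (\<Lambda> N') A')"
    by (rule Suc.hyps(1)[OF s]) (use Suc.prems sizes in \<open>auto simp: B C add_mset_commute\<close>)
  finally show ?case by (simp add: B C)
qed

lemma prod_form_union:
  assumes P: "form u P" and \<Lambda>: "form v \<Lambda>" and N: "size N = Suc v" and A: "size A = u"
  shows "prod_form v P \<Lambda> (N + A) = P (add_mset (\<Lambda> N) A)"
proof -
  define N' where "N' = (SOME N'. N' \<subseteq># N + A \<and> size N' = Suc v)"
  have N': "N' \<subseteq># N + A \<and> size N' = Suc v"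
    unfolding N'_def by (rule someI[of _ N]) (simp add: N)
  then have "P (add_mset (\<Lambda> N') (N + A - N')) = P (add_mset (\<Lambda> N) A)"
    by (intro prod_form_indep[OF P \<Lambda>]) (auto simp: N A size_Diff_submset)
  then show ?thesis by (simp add: prod_form_def N'_def)
qed

lemma mset_split_size:
  fixes M :: "'c multiset"
  assumes "size M = a + b"
  obtains N A where "M = N + A" "size N = a" "size A = (b::nat)"
proof -
  obtain xs where "mset xs = M" using ex_mset by blast
  then have "M = mset (take a xs) + mset (drop a xs)" "length xs = a + b"
    using assms by (auto simp flip: mset_append)
  then show ?thesis by (intro that) auto
qed

lemma form_prod_form:
  assumes P: "form u P" and \<Lambda>: "form v \<Lambda>"
  shows "form (u + v) (prod_form v P \<Lambda>)"
  unfolding form_def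
proof (intro allI impI)
  fix M :: "'b multiset" assume "size M = u + v"
  then obtain N A where M: "M = N + A" and N: "size N = v" and A: "size A = u"
    using mset_split_size[of M v u] by (auto simp: add.commute)
  have "prod_form v P \<Lambda> (add_mset a M) = P (add_mset (\<Lambda> (add_mset a N)) A)" for a
    using prod_form_union[OF P \<Lambda>, of "add_mset a N" A] by (simp add: N A M)
  then show "(\<lambda>a. prod_form v P \<Lambda> (add_mset a M)) \<in> mult_ops"
    using mult_ops.comp[OF formD[OF P A] formD[OF \<Lambda> N]] by simp
qed

text \<open>
  The Leibniz rule for forms.
\<close>

lemma deriv_form_prod_form:
  assumes P: "form u P" and \<Lambda>: "form v \<Lambda>" and N: "size N = Suc v" and A: "size A = u"
  shows "deriv_form (prod_form v P \<Lambda>) (add_mset c (N + A))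
    = deriv_form P (add_mset (\<Lambda> N) (add_mset c A)) + P (add_mset (deriv_form \<Lambda> (add_mset c N)) A)"
proof -
  have "deriv_form (prod_form v P \<Lambda>) (add_mset c (N + A)) = prod_form v P \<Lambda> (N + A) \<cdot> c
      - ((\<Sum>a\<in>#N. prod_form v P \<Lambda> (add_mset (a \<cdot> c) (N + A - {#a#})))
         + (\<Sum>a\<in>#A. prod_form v P \<Lambda> (add_mset (a \<cdot> c) (N + A - {#a#}))))"
    by (subst deriv_form_add_mset[OF form_prod_form[OF P \<Lambda>]]) (simp_all add: N A)
  also have "(\<Sum>a\<in>#N. prod_form v P \<Lambda> (add_mset (a \<cdot> c) (N + A - {#a#})))
      = (\<Sum>a\<in>#N. P (add_mset (\<Lambda> (add_mset (a \<cdot> c) (N - {#a#}))) A))"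
  proof (intro arg_cong[of _ _ sum_mset] image_mset_cong)
    fix a assume "a \<in># N"
    then have "add_mset (a \<cdot> c) (N + A - {#a#}) = add_mset (a \<cdot> c) (N - {#a#}) + A"
      and "size (add_mset (a \<cdot> c) (N - {#a#})) = Suc v"
      using N by (auto simp: size_Diff_singleton)
    then show "prod_form v P \<Lambda> (add_mset (a \<cdot> c) (N + A - {#a#}))
        = P (add_mset (\<Lambda> (add_mset (a \<cdot> c) (N - {#a#}))) A)"
      using prod_form_union[OF P \<Lambda> _ A] by metis
  qed
  also have "(\<Sum>a\<in>#A. prod_form v P \<Lambda> (add_mset (a \<cdot> c) (N + A - {#a#})))
      = (\<Sum>a\<in>#A. P (add_mset (\<Lambda> N) (add_mset (a \<cdot> c) (A - {#a#}))))"
  proof (intro arg_cong[of _ _ sum_mset] image_mset_cong)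
    fix a assume a: "a \<in># A"
    then have "add_mset (a \<cdot> c) (N + A - {#a#}) = N + add_mset (a \<cdot> c) (A - {#a#})"
      and "size (add_mset (a \<cdot> c) (A - {#a#})) = u"
      using A by (auto simp: size_Suc_Diff1)
    then show "prod_form v P \<Lambda> (add_mset (a \<cdot> c) (N + A - {#a#}))
        = P (add_mset (\<Lambda> N) (add_mset (a \<cdot> c) (A - {#a#})))"
      using prod_form_union[OF P \<Lambda> N] by metis
  qed
  also have "prod_form v P \<Lambda> (N + A) = P (add_mset (\<Lambda> N) A)"
    by (rule prod_form_union[OF P \<Lambda> N A])
  finally have 1: "deriv_form (prod_form v P \<Lambda>) (add_mset c (N + A)) = P (add_mset (\<Lambda> N) A) \<cdot> c
      - ((\<Sum>a\<in>#N. P (add_mset (\<Lambda> (add_mset (a \<cdot> c) (N - {#a#}))) A))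
        + (\<Sum>a\<in>#A. P (add_mset (\<Lambda> N) (add_mset (a \<cdot> c) (A - {#a#})))))" .
  have "(\<Sum>a\<in>#A. P (add_mset (a \<cdot> c) (add_mset (\<Lambda> N) A - {#a#})))
      = (\<Sum>a\<in>#A. P (add_mset (\<Lambda> N) (add_mset (a \<cdot> c) (A - {#a#}))))"
    by (intro arg_cong[of _ _ sum_mset] image_mset_cong)
       (simp add: multiset_add_sub_el_shuffle add_mset_commute)
  then have 2: "deriv_form P (add_mset c (add_mset (\<Lambda> N) A)) = P (add_mset (\<Lambda> N) A) \<cdot> c
      - (P (add_mset (\<Lambda> N \<cdot> c) A)
        + (\<Sum>a\<in>#A. P (add_mset (\<Lambda> N) (add_mset (a \<cdot> c) (A - {#a#})))))"
    by (subst deriv_form_add_mset[OF P]) (simp_all add: A)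
  have 3: "P (add_mset (deriv_form \<Lambda> (add_mset c N)) A) = P (add_mset (\<Lambda> N \<cdot> c) A)
      - (\<Sum>a\<in>#N. P (add_mset (\<Lambda> (add_mset (a \<cdot> c) (N - {#a#}))) A))"
    using mult_ops_diff[OF formD[OF P A]] mult_ops_sum_mset[OF formD[OF P A]]
    by (simp add: deriv_form_add_mset[OF \<Lambda> N])
  show ?thesis
    unfolding 1 2 3 add_mset_commute[of "\<Lambda> N" c] by (simp only: algebra_simps)
qed

text \<open>
  The form \<open>letter_form a j\<close> multiplies its \<open>j + 1\<close> arguments by the derivative of order \<open>j + 1\<close>
  of \<open>a\<close>. The shift by one makes \<open>j\<close> the weight of the form; an undifferentiated letter would have
  weight \<open>-1\<close> and is an argument instead.
\<close>

primrec letter_form :: "'b \<Rightarrow> nat \<Rightarrow> 'b multiset \<Rightarrow> 'b" where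
  "letter_form a 0 = (\<lambda>M. a \<cdot> sum_mset M)"
| "letter_form a (Suc j) = deriv_form (letter_form a j)"

lemma form_letter_form: "form j (letter_form a j)"
proof (induction j)
  case 0
  show ?case by (simp add: form_def mult_ops.left)
qed (simp add: form_deriv_form)

text \<open>
  The product of the letter forms. The identity, which is the form of weight \<open>0\<close> of the empty
  product, is written \<open>sum_mset\<close> because this returns the element of a singleton.
\<close>

primrec list_form :: "('b \<times> nat) list \<Rightarrow> 'b multiset \<Rightarrow> 'b" where
  "list_form [] = sum_mset"
| "list_form (q # qs) = prod_form (sum_list (map snd qs)) (letter_form (fst q) (snd q)) (list_form qs)"

lemma form_list_form: "form (sum_list (map snd qs)) (list_form qs)"
proof (induction qs)
  case Nil
  show ?case by (simp add: form_def mult_ops.ident)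
next
  case (Cons q qs)
  then show ?case using form_prod_form[OF form_letter_form Cons] by simp
qed

lemma list_form_Cons:
  assumes "size N = Suc (sum_list (map snd qs))" "size A = snd q"
  shows "list_form (q # qs) (N + A) = letter_form (fst q) (snd q) (add_mset (list_form qs N) A)"
  using prod_form_union[OF form_letter_form form_list_form assms] by simp

lemma list_form_move:
  assumes "size M = Suc (snd q + sum_list (map snd (xs @ ys)))"
  shows "list_form (xs @ q # ys) M = list_form (q # xs @ ys) M"
  using assms
proof (induction xs arbitrary: M)
  case Nil
  then show ?case by simp
next
  case (Cons p xs)
  let ?w = "sum_list (map snd (xs @ ys))"
  have "size M = (Suc ?w + snd q) + snd p" using Cons.prems by simp
  then obtain M' B where M: "M = M' + B" and M': "size M' = Suc ?w + snd q" and B: "size B = snd p"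
    by (rule mset_split_size)
  from M' obtain N A where M'': "M' = N + A" and N: "size N = Suc ?w" and A: "size A = snd q"
    by (rule mset_split_size)
  note P = formD[OF form_letter_form B, of "fst p"] and Q = formD[OF form_letter_form A, of "fst q"]
  have "list_form (p # xs @ q # ys) M = letter_form (fst p) (snd p) (add_mset (list_form (xs @ q # ys) M') B)"
    unfolding M by (rule list_form_Cons) (use M' B in auto)
  also have "list_form (xs @ q # ys) M' = list_form (q # xs @ ys) M'"
    by (rule Cons.IH) (use M' in auto)
  also have "\<dots> = letter_form (fst q) (snd q) (add_mset (list_form (xs @ ys) N) A)"
    unfolding M'' by (rule list_form_Cons[OF N A])
  also have "letter_form (fst p) (snd p) (add_mset \<dots> B)
      = letter_form (fst q) (snd q) (add_mset (letter_form (fst p) (snd p) (add_mset (list_form (xs @ ys) N) B)) A)"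
    by (rule mult_ops_commute[OF P Q])
  also have "letter_form (fst p) (snd p) (add_mset (list_form (xs @ ys) N) B) = list_form (p # xs @ ys) (N + B)"
    by (rule list_form_Cons[OF N B, symmetric])
  also have "letter_form (fst q) (snd q) (add_mset \<dots> A) = list_form (q # p # xs @ ys) ((N + B) + A)"
    by (rule list_form_Cons[symmetric]) (use N B A in auto)
  also have "(N + B) + A = M" by (simp add: M M'')
  finally show ?case by simp
qed

lemma list_form_mset:
  assumes "mset xs = mset ys" "size M = Suc (sum_list (map snd xs))"
  shows "list_form xs M = list_form ys M"
  using assms
proof (induction xs arbitrary: ys M)
  case Nil
  then show ?case by simp
next
  case (Cons q xs)
  then have "q \<in> set ys" by (metis list.set_intros(1) set_mset_mset)
  then obtain ys1 ys2 where ys: "ys = ys1 @ q # ys2" by (meson split_list)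
  with Cons.prems(1) have xs: "mset xs = mset (ys1 @ ys2)" by simp
  then have w: "sum_list (map snd xs) = sum_list (map snd (ys1 @ ys2))"
    by (metis mset_map sum_mset_sum_list)
  have "size M = Suc (sum_list (map snd xs)) + snd q" using Cons.prems(2) by simp
  then obtain N A where M: "M = N + A" and N: "size N = Suc (sum_list (map snd xs))"
    and A: "size A = snd q" by (rule mset_split_size)
  have "list_form (q # xs) M = letter_form (fst q) (snd q) (add_mset (list_form xs N) A)"
    unfolding M by (rule list_form_Cons[OF N A])
  also have "list_form xs N = list_form (ys1 @ ys2) N"
    by (rule Cons.IH[OF xs N])
  also have "letter_form (fst q) (snd q) (add_mset \<dots> A) = list_form (q # ys1 @ ys2) M"
    unfolding M by (rule list_form_Cons[symmetric]) (use N A w in auto)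
  also have "\<dots> = list_form ys M"
    unfolding ys by (rule list_form_move[symmetric]) (use Cons.prems(2) w in simp)
  finally show ?case .
qed

abbreviation weight :: "('b \<times> nat) multiset \<Rightarrow> nat" where
  "weight Q \<equiv> \<Sum>q\<in>#Q. snd q"

lemma weight_mset: "weight (mset qs) = sum_list (map snd qs)"
  by (induction qs) simp_all

text \<open>
  Products of letter forms do not depend on the order of the factors (\<open>list_form_mset\<close>), so that they
  are determined by the multiset of the factors.
\<close>

definition monomial_form :: "('b \<times> nat) multiset \<Rightarrow> 'b multiset \<Rightarrow> 'b" where
  "monomial_form Q = list_form (SOME qs. mset qs = Q)"

lemma monomial_form_eq:
  assumes "mset qs = Q"
  shows "size M = Suc (weight Q) \<Longrightarrow> monomial_form Q M = list_form qs M"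
proof -
  assume M: "size M = Suc (weight Q)"
  have "mset (SOME qs. mset qs = Q) = Q" using ex_mset[of Q] by (rule someI_ex)
  moreover from this have "weight Q = sum_list (map snd (SOME qs. mset qs = Q))"
    using weight_mset[of "SOME qs. mset qs = Q"] by simp
  ultimately show ?thesis unfolding monomial_form_def using M assms by (intro list_form_mset) auto
qed

lemma form_monomial_form: "form (weight Q) (monomial_form Q)"
proof -
  have "mset (SOME qs. mset qs = Q) = Q" using ex_mset[of Q] by (rule someI_ex)
  then have "weight Q = sum_list (map snd (SOME qs. mset qs = Q))"
    using weight_mset[of "SOME qs. mset qs = Q"] by simp
  then show ?thesis unfolding monomial_form_def using form_list_form by simp
qed

lemma monomial_form_empty: "monomial_form {#} = sum_mset"
  by (simp add: monomial_form_def)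

lemma monomial_form_add_mset:
  assumes N: "size N = Suc (weight Q)" and A: "size A = snd q"
  shows "monomial_form (add_mset q Q) (N + A) = letter_form (fst q) (snd q) (add_mset (monomial_form Q N) A)"
proof -
  obtain qs where qs: "mset qs = Q" using ex_mset by blast
  then have w: "weight Q = sum_list (map snd qs)" using weight_mset[of qs] by simp
  have "monomial_form (add_mset q Q) (N + A) = list_form (q # qs) (N + A)"
    by (rule monomial_form_eq) (use qs N A in auto)
  also have "\<dots> = letter_form (fst q) (snd q) (add_mset (list_form qs N) A)"
    by (rule list_form_Cons) (use N A w in auto)
  also have "list_form qs N = monomial_form Q N"
    by (rule monomial_form_eq[symmetric]) (use qs N in auto)
  finally show ?thesis .
qed

text \<open>
  A product of forms is the composition of its two parts.
\<close>

lemma monomial_form_union: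
  assumes "size N = Suc (weight P)" "size A = weight Q"
  shows "monomial_form (Q + P) (N + A) = monomial_form Q (add_mset (monomial_form P N) A)"
  using assms(2)
proof (induction Q arbitrary: A)
  case empty
  then show ?case by (simp add: monomial_form_empty)
next
  case (add q Q)
  then have "size A = weight Q + snd q" by simp
  then obtain A1 A2 where A: "A = A1 + A2" and A1: "size A1 = weight Q" and A2: "size A2 = snd q"
    by (rule mset_split_size)
  have "monomial_form (add_mset q (Q + P)) ((N + A1) + A2)
      = letter_form (fst q) (snd q) (add_mset (monomial_form (Q + P) (N + A1)) A2)"
    by (rule monomial_form_add_mset) (use assms(1) A1 A2 in auto)
  also have "monomial_form (Q + P) (N + A1) = monomial_form Q (add_mset (monomial_form P N) A1)"
    by (rule add.IH[OF A1])
  also have "letter_form (fst q) (snd q) (add_mset \<dots> A2) = monomial_form (add_mset q Q) ((add_mset (monomial_form P N) A1) + A2)"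
    by (rule monomial_form_add_mset[symmetric]) (use A1 A2 in auto)
  finally show ?case by (simp add: A add.assoc)
qed

lemma deriv_form_cong:
  assumes "form w \<Lambda>" "form w \<Lambda>'" "\<And>M. size M = Suc w \<Longrightarrow> \<Lambda> M = \<Lambda>' M" "size M = Suc (Suc w)"
  shows "deriv_form \<Lambda> M = deriv_form \<Lambda>' M"
proof -
  obtain c N where M: "M = add_mset c N" using assms(4) by (metis size_eq_Suc_imp_eq_union)
  then have N: "size N = Suc w" using assms(4) by simp
  have "(\<Sum>a\<in>#N. \<Lambda> (add_mset (a \<cdot> c) (N - {#a#}))) = (\<Sum>a\<in>#N. \<Lambda>' (add_mset (a \<cdot> c) (N - {#a#})))"
    by (intro arg_cong[of _ _ sum_mset] image_mset_cong assms(3)) (simp add: N size_Suc_Diff1)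
  then show ?thesis using N assms(1,2,3) by (simp add: M deriv_form_add_mset)
qed

text \<open>
  The Leibniz rule for a product of letters. The derivative of a letter raises its order by one.
\<close>

lemma deriv_form_monomial_form:
  "size M = Suc (Suc (weight Q)) \<Longrightarrow>
     deriv_form (monomial_form Q) M = (\<Sum>q\<in>#Q. monomial_form (add_mset (apsnd Suc q) (Q - {#q#})) M)"
proof (induction Q arbitrary: M)
  case empty
  then have "size M = Suc (Suc 0)" by simp
  then obtain a N where "M = add_mset a N" "size N = Suc 0"
    by (metis size_eq_Suc_imp_eq_union size_add_mset nat.inject)
  moreover then obtain c where "N = {#c#}" by (metis size_1_singleton_mset One_nat_def)
  ultimately have "M = {#a, c#}" by simp
  moreover have "form 0 sum_mset" by (simp add: form_def mult_ops.ident)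
  ultimately show ?case by (simp add: monomial_form_empty deriv_form_add_mset[of 0])
next
  case (add q Q)
  let ?w = "weight Q"
  have "size M = (1 + Suc ?w) + snd q" using add.prems by simp
  then obtain M' A where M: "M = M' + A" and M': "size M' = 1 + Suc ?w" and A: "size A = snd q"
    by (rule mset_split_size)
  from M' obtain c N where M'': "M' = add_mset c N" using size_eq_Suc_imp_eq_union[of M' "Suc ?w"] by auto
  with M' have N: "size N = Suc ?w" by simp
  have "deriv_form (monomial_form (add_mset q Q)) M = deriv_form (prod_form ?w (letter_form (fst q) (snd q)) (monomial_form Q)) M"
  proof (rule deriv_form_cong)
    show "form (snd q + ?w) (monomial_form (add_mset q Q))" using form_monomial_form[of "add_mset q Q"] by simp
    show "form (snd q + ?w) (prod_form ?w (letter_form (fst q) (snd q)) (monomial_form Q))"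
      by (rule form_prod_form[OF form_letter_form form_monomial_form])
    show "size M = Suc (Suc (snd q + ?w))" using add.prems by simp
    fix M :: "'b multiset" assume "size M = Suc (snd q + ?w)"
    then have "size M = Suc ?w + snd q" by simp
    then obtain N A where M: "M = N + A" and N: "size N = Suc ?w" and A: "size A = snd q"
      by (rule mset_split_size)
    show "monomial_form (add_mset q Q) M = prod_form ?w (letter_form (fst q) (snd q)) (monomial_form Q) M"
      unfolding M prod_form_union[OF form_letter_form form_monomial_form N A] by (rule monomial_form_add_mset[OF N A])
  qed
  also have "\<dots> = deriv_form (letter_form (fst q) (snd q)) (add_mset (monomial_form Q N) (add_mset c A))
      + letter_form (fst q) (snd q) (add_mset (deriv_form (monomial_form Q) M') A)"
    using deriv_form_prod_form[OF form_letter_form form_monomial_form N A] by (simp add: M M'')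
  also have "deriv_form (letter_form (fst q) (snd q)) (add_mset (monomial_form Q N) (add_mset c A))
      = monomial_form (add_mset (apsnd Suc q) Q) M"
    using monomial_form_add_mset[OF N, of "add_mset c A" "apsnd Suc q"] A by (simp add: M M'' apsnd_def map_prod_def split: prod.splits)
  also have "letter_form (fst q) (snd q) (add_mset (deriv_form (monomial_form Q) M') A)
      = (\<Sum>p\<in>#Q. monomial_form (add_mset (apsnd Suc p) (add_mset q Q - {#p#})) M)"
  proof -
    have "letter_form (fst q) (snd q) (add_mset (deriv_form (monomial_form Q) M') A)
      = letter_form (fst q) (snd q) (add_mset (\<Sum>p\<in>#Q. monomial_form (add_mset (apsnd Suc p) (Q - {#p#})) M') A)"
      using add.IH[of M'] M' by simp
    also have "\<dots> = (\<Sum>p\<in>#Q. letter_form (fst q) (snd q) (add_mset (monomial_form (add_mset (apsnd Suc p) (Q - {#p#})) M') A))"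
      by (rule mult_ops_sum_mset[OF formD[OF form_letter_form A]])
    also have "\<dots> = (\<Sum>p\<in>#Q. monomial_form (add_mset (apsnd Suc p) (add_mset q Q - {#p#})) M)"
    proof (intro arg_cong[of _ _ sum_mset] image_mset_cong)
      fix p assume p: "p \<in># Q"
      then obtain R where R: "Q = add_mset p R" by (metis multi_member_split)
      have "monomial_form (add_mset q (add_mset (apsnd Suc p) R)) (M' + A)
        = letter_form (fst q) (snd q) (add_mset (monomial_form (add_mset (apsnd Suc p) R) M') A)"
        by (rule monomial_form_add_mset) (use M' A in \<open>auto simp: R apsnd_def map_prod_def split: prod.splits\<close>)
      then show "letter_form (fst q) (snd q) (add_mset (monomial_form (add_mset (apsnd Suc p) (Q - {#p#})) M') A)
        = monomial_form (add_mset (apsnd Suc p) (add_mset q Q - {#p#})) M"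
        using add_mset_commute[of p q R] by (simp add: R M add_mset_commute)
    qed
    finally show ?thesis .
  qed
  finally show ?case by simp
qed

text \<open>
  The differentiated letters of \<open>m\<close> act as a form on the undifferentiated ones. For the form to receive as many
  arguments as it takes, \<open>m\<close> must be balanced: \<open>size m = weight m + 1\<close>.
\<close>

definition monomial_value :: "('b \<times> nat) multiset \<Rightarrow> 'b" where
  "monomial_value m = monomial_form (image_mset (apsnd (\<lambda>k. k - 1)) (filter_mset (\<lambda>l. snd l > 0) m))
     (image_mset fst (filter_mset (\<lambda>l. snd l = 0) m))"

text \<open>
  Balanced monomials are handled through their two parts: the letters \<open>Q\<close> of positive order, with
  the order lowered by one as in \<open>letter_form\<close>, and the multiset \<open>Z\<close> of letters of order \<open>0\<close>.
\<close>

definition monomial_of :: "('b \<times> nat) multiset \<Rightarrow> 'b multiset \<Rightarrow> ('b \<times> nat) multiset" where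
  "monomial_of Q Z = image_mset (apsnd Suc) Q + image_mset (\<lambda>a. (a, 0)) Z"

lemma monomial_value_of: "monomial_value (monomial_of Q Z) = monomial_form Q Z"
proof -
  have "image_mset (apsnd (\<lambda>k. k - 1)) (filter_mset (\<lambda>l. snd l > 0) (monomial_of Q Z)) = Q"
    by (simp add: monomial_of_def filter_mset_image_mset multiset.map_comp)
       (rule multiset.map_ident_strong, auto)
  moreover have "image_mset fst (filter_mset (\<lambda>l. snd l = 0) (monomial_of Q Z)) = Z"
    by (simp add: monomial_of_def filter_mset_image_mset multiset.map_comp comp_def)
  ultimately show ?thesis by (simp add: monomial_value_def)
qed

lemma monomial_of_exists:
  assumes "size m = Suc (weight m)"
  obtains Q Z where "m = monomial_of Q Z" "size Z = Suc (weight Q)"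
proof -
  define Q where "Q = image_mset (apsnd (\<lambda>k. k - 1)) (filter_mset (\<lambda>l. snd l > 0) m)"
  define Z where "Z = image_mset fst (filter_mset (\<lambda>l. snd l = 0) m)"
  have "m = filter_mset (\<lambda>l. snd l > 0) m + filter_mset (\<lambda>l. \<not> snd l > 0) m"
    by (rule multiset_partition)
  also have "filter_mset (\<lambda>l. snd l > 0) m = image_mset (apsnd Suc) Q"
    unfolding Q_def multiset.map_comp
    by (rule multiset.map_ident_strong[symmetric]) auto
  also have "filter_mset (\<lambda>l. \<not> snd l > 0) m = filter_mset (\<lambda>l. snd l = 0) m"
    by simp
  also have "filter_mset (\<lambda>l. snd l = 0) m = image_mset (\<lambda>a. (a, 0)) Z"
    unfolding Z_def multiset.map_comp
    by (rule multiset.map_ident_strong[symmetric]) auto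
  finally have m: "m = monomial_of Q Z" by (simp add: monomial_of_def)
  have "weight m = size Q + weight Q"
    unfolding m monomial_of_def by (induction Q) (simp_all add: multiset.map_comp comp_def)
  with assms have "size Z = Suc (weight Q)"
    by (simp add: m monomial_of_def)
  with m show ?thesis by (rule that)
qed

text \<open>
  The left side is the value of the product of the derivative of \<open>m\<close> with \<open>m'\<close>. Let \<open>c\<close> be the value
  of \<open>m'\<close>. If a letter of positive order in \<open>m\<close> is differentiated,
  then the form of \<open>m\<close> is replaced by a summand of its derivative, which has \<open>c\<close> as the additional
  argument. If an argument \<open>z\<close> is differentiated, then it is replaced by \<open>z \<cdot> c\<close>. By the definition of
  \<open>deriv_form\<close>, these terms add up to the product of the two values.
\<close>

lemma monomial_value_mult:
  assumes "size m = Suc (weight m)" "size m' = Suc (weight m')"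
  shows "(\<Sum>l\<in>#m. monomial_value (add_mset (apsnd Suc l) (m - {#l#}) + m'))
       = monomial_value m \<cdot> monomial_value m'"
proof -
  obtain Q Z where m: "m = monomial_of Q Z" and Z: "size Z = Suc (weight Q)"
    using assms(1) by (rule monomial_of_exists)
  obtain Q' Z' where m': "m' = monomial_of Q' Z'" and Z': "size Z' = Suc (weight Q')"
    using assms(2) by (rule monomial_of_exists)
  define c where "c = monomial_form Q' Z'"
  have "(\<Sum>q\<in>#Q. monomial_value (add_mset (apsnd Suc (apsnd Suc q)) (m - {#apsnd Suc q#}) + m'))
      = (\<Sum>q\<in>#Q. monomial_form (add_mset (apsnd Suc q) (Q - {#q#})) (add_mset c Z))"
  proof (intro arg_cong[of _ _ sum_mset] image_mset_cong)
    fix q assume "q \<in># Q"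
    then obtain R where R: "Q = add_mset q R" by (metis multi_member_split)
    have "add_mset (apsnd Suc (apsnd Suc q)) (m - {#apsnd Suc q#}) + m'
        = monomial_of (add_mset (apsnd Suc q) R + Q') (Z' + Z)"
      by (simp add: m m' R monomial_of_def)
    moreover have "monomial_form (add_mset (apsnd Suc q) R + Q') (Z' + Z)
        = monomial_form (add_mset (apsnd Suc q) R) (add_mset c Z)"
      unfolding c_def by (rule monomial_form_union[OF Z']) (use Z in \<open>simp add: R\<close>)
    ultimately show "monomial_value (add_mset (apsnd Suc (apsnd Suc q)) (m - {#apsnd Suc q#}) + m')
        = monomial_form (add_mset (apsnd Suc q) (Q - {#q#})) (add_mset c Z)"
      by (simp add: monomial_value_of R)
  qed
  also have "\<dots> = deriv_form (monomial_form Q) (add_mset c Z)"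
    by (rule deriv_form_monomial_form[symmetric]) (simp add: Z)
  also have "\<dots> = monomial_form Q Z \<cdot> c - (\<Sum>z\<in>#Z. monomial_form Q (add_mset (z \<cdot> c) (Z - {#z#})))"
    by (rule deriv_form_add_mset[OF form_monomial_form Z])
  finally have pos: "(\<Sum>q\<in>#Q. monomial_value (add_mset (apsnd Suc (apsnd Suc q)) (m - {#apsnd Suc q#}) + m'))
      = monomial_form Q Z \<cdot> c - (\<Sum>z\<in>#Z. monomial_form Q (add_mset (z \<cdot> c) (Z - {#z#})))" .
  have zero: "(\<Sum>z\<in>#Z. monomial_value (add_mset (apsnd Suc (z, 0)) (m - {#(z, 0)#}) + m'))
      = (\<Sum>z\<in>#Z. monomial_form Q (add_mset (z \<cdot> c) (Z - {#z#})))"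
  proof (intro arg_cong[of _ _ sum_mset] image_mset_cong)
    fix z assume "z \<in># Z"
    then obtain Y where Y: "Z = add_mset z Y" by (metis multi_member_split)
    have "add_mset (apsnd Suc (z, 0)) (m - {#(z, 0)#}) + m'
        = monomial_of (Q + add_mset (z, 0) Q') (Z' + Y)"
      by (simp add: m m' Y monomial_of_def)
    moreover have "monomial_form (Q + add_mset (z, 0) Q') (Z' + Y) = monomial_form Q (add_mset (monomial_form (add_mset (z, 0) Q') Z') Y)"
      by (rule monomial_form_union) (use Z Z' in \<open>simp_all add: Y\<close>)
    moreover have "monomial_form (add_mset (z, 0) Q') Z' = z \<cdot> c"
      using monomial_form_add_mset[OF Z', of "{#}" "(z, 0)"] by (simp add: c_def)
    ultimately show "monomial_value (add_mset (apsnd Suc (z, 0)) (m - {#(z, 0)#}) + m')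
        = monomial_form Q (add_mset (z \<cdot> c) (Z - {#z#}))"
      by (simp add: monomial_value_of Y)
  qed
  have "(\<Sum>l\<in>#m. monomial_value (add_mset (apsnd Suc l) (m - {#l#}) + m'))
      = (\<Sum>q\<in>#Q. monomial_value (add_mset (apsnd Suc (apsnd Suc q)) (m - {#apsnd Suc q#}) + m'))
       + (\<Sum>z\<in>#Z. monomial_value (add_mset (apsnd Suc (z, 0)) (m - {#(z, 0)#}) + m'))"
    by (simp add: m monomial_of_def multiset.map_comp comp_def)
  also have "\<dots> = monomial_form Q Z \<cdot> c" unfolding pos zero by simp
  also have "\<dots> = monomial_value m \<cdot> monomial_value m'"
    by (simp add: m m' monomial_value_of c_def)
  finally show ?thesis .
qed

end

section \<open>The free Novikov algebra inside the differential polynomials\<close>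

text \<open>
  In every monomial the number of letters exceeds the number of derivatives by one. Indeterminates are
  balanced, and \<open>p, q \<mapsto> p' * q\<close> preserves the property: both numbers add up, and one derivative is
  new.
\<close>

definition balanced :: "('v, 'k::zero) dpoly \<Rightarrow> bool" where
  "balanced p \<longleftrightarrow> (\<forall>m\<in>keys p. size m = Suc (\<Sum>l\<in>#m. snd l))"

lemma balanced_add: "balanced p \<Longrightarrow> balanced q \<Longrightarrow> balanced (p + q)"
  using keys_add[of p q] unfolding balanced_def by blast

lemma balanced_zero: "balanced 0"
  by (simp add: balanced_def)

lemma balanced_scale: 
  fixes p :: "('v, 'k::comm_ring_1) dpoly"
  assumes "balanced p"
  shows "balanced (single 0 c * p)"
  unfolding balanced_def
proof
  fix m assume "m \<in> keys (single 0 c * p)"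
  with keys_mult[of "single 0 c" p] obtain a b where "m = a + b" "a \<in> keys (single (0 :: ('v \<times> nat) multiset) c)" "b \<in> keys p"
    by blast
  then have "m \<in> keys p" by (simp split: if_splits)
  with assms show "size m = Suc (\<Sum>l\<in>#m. snd l)" by (simp add: balanced_def)
qed

lemma keys_sum_mset: "m \<in> keys (\<Sum>i\<in>#I. p i) \<Longrightarrow> \<exists>i\<in>#I. m \<in> keys (p i)"
proof (induction I)
  case (add i I)
  then show ?case using keys_add[of "p i" "\<Sum>i\<in>#I. p i"] by auto
qed simp

lemma keys_sum: "m \<in> keys (\<Sum>i\<in>I. p i) \<Longrightarrow> \<exists>i\<in>I. m \<in> keys (p i)"
proof (induction I rule: infinite_finite_induct)
  case (insert i I)
  then show ?case using keys_add[of "p i" "\<Sum>i\<in>I. p i"] by auto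
qed simp_all

lemma keys_ddt:
  assumes "m \<in> keys (ddt p)"
  obtains n l where "n \<in> keys p" "l \<in># n" "m = raise l n"
proof -
  from keys_sum[OF assms[unfolded ddt_def linear_ext_def]]
  obtain n where n: "n \<in> keys p" "m \<in> keys (\<Sum>l\<in>#n. single (raise l n) (lookup p n))"
    by blast
  from keys_sum_mset[OF n(2)] obtain l where "l \<in># n" "m \<in> keys (single (raise l n) (lookup p n))"
    by blast
  with n(1) show ?thesis using that by (auto split: if_splits)
qed

lemma balanced_ddt_mult:
  fixes p q :: "('v, 'k::comm_ring_1) dpoly"
  assumes "balanced p" "balanced q"
  shows "balanced (ddt p * q)"
  unfolding balanced_def
proof
  fix m assume "m \<in> keys (ddt p * q)"
  with keys_mult[of "ddt p" q] obtain a b where m: "m = a + b" and a: "a \<in> keys (ddt p)" and b: "b \<in> keys q"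
    by blast
  from a obtain n l where n: "n \<in> keys p" and l: "l \<in># n" and eq: "a = raise l n"
    by (rule keys_ddt)
  from l obtain n' where "n = add_mset l n'" by (metis multi_member_split)
  then show "size m = Suc (\<Sum>l\<in>#m. snd l)"
    using assms n b by (fastforce simp: balanced_def m eq raise_def)
qed

context novikov_algebra
begin

definition dpoly_value :: "('v \<Rightarrow> 'b) \<Rightarrow> ('v, 'a) dpoly \<Rightarrow> 'b" where
  "dpoly_value h = linear_ext (\<lambda>m c. scale c (monomial_value (image_mset (apfst h) m)))"

lemma additive_dpoly_value:
  "additive_family (\<lambda>m c. scale c (monomial_value (image_mset (apfst h) m)))"
  by (simp add: additive_family_def scale_left_distrib)

lemma dpoly_value_add: "dpoly_value h (p + q) = dpoly_value h p + dpoly_value h q"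
  unfolding dpoly_value_def by (rule linear_ext_add[OF additive_dpoly_value])

lemma dpoly_value_zero: "dpoly_value h 0 = 0"
  unfolding dpoly_value_def by (rule linear_ext_zero)

lemma dpoly_value_sum: "dpoly_value h (\<Sum>i\<in>I. p i) = (\<Sum>i\<in>I. dpoly_value h (p i))"
  unfolding dpoly_value_def by (rule linear_ext_sum[OF additive_dpoly_value])

lemma dpoly_value_sum_mset: "dpoly_value h (\<Sum>i\<in>#I. p i) = (\<Sum>i\<in>#I. dpoly_value h (p i))"
  unfolding dpoly_value_def by (rule linear_ext_sum_mset[OF additive_dpoly_value])

lemma dpoly_value_single:
  "dpoly_value h (single m c) = scale c (monomial_value (image_mset (apfst h) m))"
  unfolding dpoly_value_def by (rule linear_ext_single[OF additive_dpoly_value])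

lemma dpoly_value_scale: "dpoly_value h (single 0 c * p) = scale c (dpoly_value h p)"
  by (induction p rule: poly_mapping_add_induct)
     (simp_all add: mult_single dpoly_value_single dpoly_value_add distrib_left scale_right_distrib)

lemma dpoly_value_cong:
  assumes "\<And>v k. (v, k) \<in> letters p \<Longrightarrow> h v = h' v"
  shows "dpoly_value h p = dpoly_value h' p"
  unfolding dpoly_value_def linear_ext_def
proof (rule sum.cong[OF HOL.refl])
  fix m assume m: "m \<in> keys p"
  have "image_mset (apfst h) m = image_mset (apfst h') m"
  proof (rule image_mset_cong)
    fix l assume "l \<in># m"
    with m have "(fst l, snd l) \<in> letters p" by (auto simp: letters_def)
    from assms[OF this] show "apfst h l = apfst h' l" by (simp add: prod_eq_iff)
  qed
  then show "scale (lookup p m) (monomial_value (image_mset (apfst h) m))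
      = scale (lookup p m) (monomial_value (image_mset (apfst h') m))" by simp
qed

lemma dpoly_value_letter: "dpoly_value h (letter (v, 0)) = h v"
  using monomial_value_of[of "{#}" "{#h v#}"]
  by (simp add: dpoly_value_single monomial_of_def monomial_form_empty)

lemma sum_mset_scale: "scale c (\<Sum>i\<in>#I. f i) = (\<Sum>i\<in>#I. scale c (f i))"
  by (induction I) (simp_all add: scale_right_distrib)

lemma dpoly_value_single_mult:
  fixes m n :: "('v \<times> nat) multiset"
  assumes "size m = Suc (\<Sum>l\<in>#m. snd l)" "size n = Suc (\<Sum>l\<in>#n. snd l)"
  shows "dpoly_value h (ddt (single m a) * single n b)
    = dpoly_value h (single m a) \<cdot> dpoly_value h (single n b)"
proof -
  let ?f = "image_mset (apfst h)"
  have weight_image: "weight (?f m) = (\<Sum>l\<in>#m. snd l)" for m :: "('v \<times> nat) multiset"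
    by (simp add: multiset.map_comp comp_def)
  have raise_image: "?f (raise l m) = add_mset (apsnd Suc (apfst h l)) (?f m - {#apfst h l#})"
    if "l \<in># m" for l
    using that by (simp add: raise_def image_mset_Diff prod_eq_iff)
  have "dpoly_value h (ddt (single m a) * single n b)
      = (\<Sum>l\<in>#m. scale (a * b) (monomial_value (?f (raise l m) + ?f n)))"
    by (simp add: ddt_single sum_mset_distrib_right mult_single dpoly_value_sum_mset dpoly_value_single)
  also have "\<dots> = (\<Sum>l\<in>#m. scale (a * b) (monomial_value
      (add_mset (apsnd Suc (apfst h l)) (?f m - {#apfst h l#}) + ?f n)))"
    by (intro arg_cong[of _ _ sum_mset] image_mset_cong) (simp add: raise_image)
  also have "\<dots> = scale (a * b) (\<Sum>l\<in>#?f m. monomial_value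
      (add_mset (apsnd Suc l) (?f m - {#l#}) + ?f n))"
    by (simp add: sum_mset_scale multiset.map_comp comp_def)
  also have "\<dots> = scale (a * b) (monomial_value (?f m) \<cdot> monomial_value (?f n))"
    using assms by (subst monomial_value_mult) (simp_all only: weight_image size_image_mset)
  also have "\<dots> = dpoly_value h (single m a) \<cdot> dpoly_value h (single n b)"
    by (simp add: dpoly_value_single mult_scale_left mult_scale_right)
  finally show ?thesis .
qed

lemma sum_mult_left: "(\<Sum>i\<in>I. f i) \<cdot> b = (\<Sum>i\<in>I. f i \<cdot> b)"
proof (induction I rule: infinite_finite_induct)
  have "0 \<cdot> b = 0" using mult_add_left[of 0 0 b] by simp
  then show "sum f I \<cdot> b = (\<Sum>i\<in>I. f i \<cdot> b)" if "infinite I" for I using that by simp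
  then show "sum f {} \<cdot> b = (\<Sum>i\<in>{}. f i \<cdot> b)" using \<open>0 \<cdot> b = 0\<close> by simp
qed (simp add: mult_add_left)

lemma sum_mult_right: "a \<cdot> (\<Sum>i\<in>I. f i) = (\<Sum>i\<in>I. a \<cdot> f i)"
proof (induction I rule: infinite_finite_induct)
  have "a \<cdot> 0 = 0" using mult_add_right[of a 0 0] by simp
  then show "a \<cdot> sum f I = (\<Sum>i\<in>I. a \<cdot> f i)" if "infinite I" for I using that by simp
  then show "a \<cdot> sum f {} = (\<Sum>i\<in>{}. a \<cdot> f i)" using \<open>a \<cdot> 0 = 0\<close> by simp
qed (simp add: mult_add_right)

text \<open>
  Evaluation of balanced differential polynomials in a Novikov algebra is a homomorphism, where the
  indeterminates take the values \<open>h\<close>.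
\<close>

lemma dpoly_value_mult:
  assumes p: "balanced p" and q: "balanced q"
  shows "dpoly_value h (ddt p * q) = dpoly_value h p \<cdot> dpoly_value h q"
proof -
  have expand: "ddt p * q = (\<Sum>m\<in>keys p. \<Sum>n\<in>keys q. ddt (single m (lookup p m)) * single n (lookup q n))"
    by (subst (1) sum_singles[of p, symmetric], subst (1) sum_singles[of q, symmetric])
       (simp add: ddt_sum sum_product)
  have "dpoly_value h (ddt p * q) = (\<Sum>m\<in>keys p. \<Sum>n\<in>keys q.
      dpoly_value h (single m (lookup p m)) \<cdot> dpoly_value h (single n (lookup q n)))"
    unfolding expand dpoly_value_sum
    by (intro sum.cong HOL.refl dpoly_value_single_mult) (use p q in \<open>auto simp: balanced_def\<close>)
  also have "\<dots> = dpoly_value h (\<Sum>m\<in>keys p. single m (lookup p m))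
      \<cdot> dpoly_value h (\<Sum>n\<in>keys q. single n (lookup q n))"
    unfolding dpoly_value_sum sum_mult_left sum_mult_right by (rule sum.swap)
  finally show ?thesis unfolding sum_singles .
qed

end

interpretation dpoly:
  novikov_algebra "\<lambda>(c :: 'k::field) (p :: ('v, 'k) dpoly). single 0 c * p" "\<lambda>p q. ddt p * q"
proof
  fix r q :: 'k and a b c :: "('v, 'k) dpoly"
  show "single 0 r * (a + b) = single 0 r * a + single 0 r * b"
    by (rule distrib_left)
  show "single 0 (r + q) * a = single 0 r * a + single 0 q * a"
    by (simp only: single_add distrib_right)
  show "single 0 r * (single 0 q * a) = single 0 (r * q) * a"
    by (simp add: mult_single flip: mult.assoc)
  show "single 0 1 * a = a" by simp
  show "ddt (a + b) * c = ddt a * c + ddt b * c"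
    by (simp only: ddt_add distrib_right)
  show "ddt a * (b + c) = ddt a * b + ddt a * c"
    by (rule distrib_left)
  show "ddt (single 0 r * a) * b = single 0 r * (ddt a * b)"
    by (simp only: ddt_mult ddt_const mult_zero_left add_0_left mult.assoc)
  show "ddt a * (single 0 r * b) = single 0 r * (ddt a * b)"
    by (rule mult.left_commute)
  show "ddt (ddt a * b) * c - ddt a * (ddt b * c) = ddt (ddt a * c) * b - ddt a * (ddt c * b)"
    by (simp add: ddt_mult algebra_simps)
  show "ddt a * (ddt b * c) = ddt b * (ddt a * c)"
    by (rule mult.left_commute)
qed

lemma free_novikov_generated:
  fixes a :: "('v, 'k::field) free_novikov"
  assumes S: "free_novikov.subalgebra S" and vars: "\<And>v. nov_var v \<in> S"
  shows "a \<in> S"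
proof (induction a rule: free_novikov.abs_induct)
  fix t :: "('v, 'k) nov_term"
  have sub: "free_novikov.subspace S" and mult: "\<And>a b. a \<in> S \<Longrightarrow> b \<in> S \<Longrightarrow> a * b \<in> S"
    using S by (auto simp: free_novikov.subalgebra_def)
  show "abs_free_novikov t \<in> S"
  proof (induction t)
    case (Var v)
    then show ?case using vars by (simp flip: nov_var.abs_eq)
  next
    case Zero
    then show ?case using free_novikov.subspace_0[OF sub] by (simp flip: zero_free_novikov.abs_eq)
  next
    case (Add s t)
    then show ?case using free_novikov.subspace_add[OF sub] by (simp flip: plus_free_novikov.abs_eq)
  next
    case (Scale r t)
    then show ?case using free_novikov.subspace_scale[OF sub] by (simp flip: nov_scale.abs_eq)
  next
    case (Mult s t)
    then show ?case using mult by (simp flip: times_free_novikov.abs_eq)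
  qed
qed

definition dpoly_of :: "('v, 'k::field) free_novikov \<Rightarrow> ('v, 'k) dpoly" where
  "dpoly_of = (SOME \<phi>. Vector_Spaces.linear nov_scale (\<lambda>c p. single 0 c * p) \<phi> \<and>
     (\<forall>a b. \<phi> (a * b) = ddt (\<phi> a) * \<phi> b) \<and> (\<forall>v. \<phi> (nov_var v) = letter (v, 0)))"

lemma dpoly_of_hom:
  "Vector_Spaces.linear nov_scale (\<lambda>c p. single 0 c * p) (dpoly_of :: ('v, 'k::field) free_novikov \<Rightarrow> _) \<and>
     (\<forall>a b :: ('v, 'k) free_novikov. dpoly_of (a * b) = ddt (dpoly_of a) * dpoly_of b) \<and>
     (\<forall>v. dpoly_of (nov_var v :: ('v, 'k) free_novikov) = letter (v, 0))"
  unfolding dpoly_of_def by (rule someI_ex[OF ex1_implies_ex[OF dpoly.free_novikov_universal]])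

lemmas linear_dpoly_of = dpoly_of_hom[THEN conjunct1]
  and dpoly_of_mult = dpoly_of_hom[THEN conjunct2, THEN conjunct1, rule_format]
  and dpoly_of_var = dpoly_of_hom[THEN conjunct2, THEN conjunct2, rule_format]

lemma dpoly_of_add: "dpoly_of (a + b) = dpoly_of a + dpoly_of b"
proof -
  interpret Vector_Spaces.linear nov_scale "\<lambda>c p. single 0 c * p" dpoly_of
    by (rule linear_dpoly_of)
  show ?thesis by (rule add)
qed

lemma dpoly_of_scale: "dpoly_of (nov_scale c a) = single 0 c * dpoly_of a"
proof -
  interpret Vector_Spaces.linear nov_scale "\<lambda>c p. single 0 c * p" dpoly_of
    by (rule linear_dpoly_of)
  show ?thesis by (rule scale)
qed

lemma dpoly_of_zero: "dpoly_of 0 = 0"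
  using dpoly_of_add[of 0 0] by (metis add_cancel_left_left add_0)

lemma free_novikov_subalgebraI:
  assumes "0 \<in> S" "\<And>a b. a \<in> S \<Longrightarrow> b \<in> S \<Longrightarrow> a + b \<in> S" "\<And>c a. a \<in> S \<Longrightarrow> nov_scale c a \<in> S"
    "\<And>a b. a \<in> S \<Longrightarrow> b \<in> S \<Longrightarrow> a * b \<in> S"
  shows "free_novikov.subalgebra S"
  unfolding free_novikov.subalgebra_def free_novikov.subspace_def using assms by blast

lemma balanced_dpoly_of: "balanced (dpoly_of a)"
proof -
  have "free_novikov.subalgebra {a. balanced (dpoly_of a)}"
    by (rule free_novikov_subalgebraI)
       (simp_all add: dpoly_of_zero balanced_zero dpoly_of_add balanced_add dpoly_of_scale balanced_scale
          dpoly_of_mult balanced_ddt_mult)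
  from free_novikov_generated[OF this, of a] show ?thesis
    by (simp add: dpoly_of_var balanced_def)
qed

lemma value_dpoly_of_in:
  fixes h :: "'v \<Rightarrow> ('v, 'k::field) free_novikov"
  assumes S: "free_novikov.subalgebra S" and h: "\<And>v. h v \<in> S"
  shows "free_novikov.dpoly_value h (dpoly_of a) \<in> S"
proof -
  have sub: "free_novikov.subspace S" and mult: "\<And>a b. a \<in> S \<Longrightarrow> b \<in> S \<Longrightarrow> a * b \<in> S"
    using S by (auto simp: free_novikov.subalgebra_def)
  have "free_novikov.subalgebra {a. free_novikov.dpoly_value h (dpoly_of a) \<in> S}"
    by (rule free_novikov_subalgebraI)
       (simp_all add: dpoly_of_zero free_novikov.dpoly_value_zero dpoly_of_add free_novikov.dpoly_value_add
         dpoly_of_scale free_novikov.dpoly_value_scale dpoly_of_mult free_novikov.dpoly_value_mult balanced_dpoly_of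
         mult free_novikov.subspace_0[OF sub] free_novikov.subspace_add[OF sub]
         free_novikov.subspace_scale[OF sub])
  from free_novikov_generated[OF this, of a] show ?thesis
    by (simp add: dpoly_of_var free_novikov.dpoly_value_letter h)
qed

text \<open>
  Evaluation at the variables is a left inverse of \<open>dpoly_of\<close>, which is therefore injective.
\<close>

lemma value_dpoly_of: "free_novikov.dpoly_value nov_var (dpoly_of a) = a"
proof -
  have "free_novikov.subalgebra {a. free_novikov.dpoly_value nov_var (dpoly_of a) = a}"
    by (rule free_novikov_subalgebraI)
       (simp_all add: dpoly_of_zero free_novikov.dpoly_value_zero dpoly_of_add free_novikov.dpoly_value_add
         dpoly_of_scale free_novikov.dpoly_value_scale dpoly_of_mult free_novikov.dpoly_value_mult balanced_dpoly_of)
  from free_novikov_generated[OF this, of a] show ?thesis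
    by (simp add: dpoly_of_var free_novikov.dpoly_value_letter)
qed

lemma generated_subalgebra_subalgebra: "free_novikov.subalgebra (free_novikov.generated_subalgebra G)"
  unfolding free_novikov.generated_subalgebra_def
  by (rule hull_in) (auto simp: free_novikov.subalgebra_def intro: free_novikov.subspace_Inter)

text \<open>
  If the image of \<open>a\<close> involves only letters of indeterminates in \<open>V\<close>, then the evaluation that sends
  all other indeterminates to \<open>0\<close> also recovers \<open>a\<close> from its image, and its values lie in
  the subalgebra.
\<close>

lemma generated_subalgebra_iff:
  fixes a :: "('v, 'k::field) free_novikov"
  shows "a \<in> free_novikov.generated_subalgebra (nov_var ` V) \<longleftrightarrow> letters (dpoly_of a) \<subseteq> V \<times> UNIV"
    (is "a \<in> ?S \<longleftrightarrow> _")
proof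
  have "free_novikov.subalgebra {a :: ('v, 'k) free_novikov. letters (dpoly_of a) \<subseteq> V \<times> UNIV}"
  proof (rule free_novikov_subalgebraI)
    fix a b :: "('v, 'k) free_novikov" and c :: 'k
    assume a: "a \<in> {a. letters (dpoly_of a) \<subseteq> V \<times> UNIV}"
    have "letters (single 0 c * dpoly_of a) \<subseteq> V \<times> UNIV"
      using letters_mult[of "single 0 c" "dpoly_of a"] letters_single[of 0 c] a by auto
    then show "nov_scale c a \<in> {a. letters (dpoly_of a) \<subseteq> V \<times> UNIV}"
      by (simp add: dpoly_of_scale)
    assume b: "b \<in> {a. letters (dpoly_of a) \<subseteq> V \<times> UNIV}"
    show "a + b \<in> {a. letters (dpoly_of a) \<subseteq> V \<times> UNIV}"
      using letters_add[of "dpoly_of a" "dpoly_of b"] a b by (auto simp: dpoly_of_add)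
    have "apsnd Suc ` letters (dpoly_of a) \<subseteq> V \<times> UNIV"
      using a by auto
    then have "letters (ddt (dpoly_of a)) \<subseteq> V \<times> UNIV"
      using letters_ddt[of "dpoly_of a"] a by blast
    then show "a * b \<in> {a. letters (dpoly_of a) \<subseteq> V \<times> UNIV}"
      using letters_mult[of "ddt (dpoly_of a)" "dpoly_of b"] b by (auto simp: dpoly_of_mult)
  qed (simp add: dpoly_of_zero)
  moreover have "nov_var ` V \<subseteq> {a :: ('v, 'k) free_novikov. letters (dpoly_of a) \<subseteq> V \<times> UNIV}"
    by (auto simp: dpoly_of_var letters_def)
  ultimately show "a \<in> ?S \<Longrightarrow> letters (dpoly_of a) \<subseteq> V \<times> UNIV"
    unfolding free_novikov.generated_subalgebra_def using hull_minimal by blast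
next
  let ?h = "\<lambda>v. if v \<in> V then nov_var v else 0"
  assume "letters (dpoly_of a) \<subseteq> V \<times> UNIV"
  then have "free_novikov.dpoly_value nov_var (dpoly_of a) = free_novikov.dpoly_value ?h (dpoly_of a)"
    by (intro free_novikov.dpoly_value_cong) auto
  moreover have "free_novikov.dpoly_value ?h (dpoly_of a) \<in> ?S"
  proof (rule value_dpoly_of_in[OF generated_subalgebra_subalgebra])
    have "0 \<in> ?S"
      using generated_subalgebra_subalgebra[of "nov_var ` V :: ('v, 'k) free_novikov set"]
      by (intro free_novikov.subspace_0) (simp add: free_novikov.subalgebra_def)
    then show "?h v \<in> ?S" for v
      using hull_subset[of "nov_var ` V" free_novikov.subalgebra]
      by (auto simp: free_novikov.generated_subalgebra_def)
  qed
  ultimately show "a \<in> ?S" by (simp add: value_dpoly_of)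
qed


section \<open>Generic zeros of differential polynomials\<close>

text \<open>
  The values of the letters lie in a field that contains the coefficients through the ring
  homomorphism \<open>emb\<close>.
\<close>

locale coefficient_field =
  fixes emb :: "'k::comm_ring_1 \<Rightarrow> 'c::field"
  assumes emb_add: "emb (a + b) = emb a + emb b"
    and emb_mult: "emb (a * b) = emb a * emb b"
    and emb_one: "emb 1 = 1"
begin

lemma emb_zero: "emb 0 = 0"
  using emb_add[of 0 0] by (metis add_cancel_left_left add_0)

definition ev :: "('v \<times> nat \<Rightarrow> 'c) \<Rightarrow> ('v, 'k) dpoly \<Rightarrow> 'c" where
  "ev e = linear_ext (\<lambda>m c. emb c * (\<Prod>l\<in>#m. e l))"

lemma additive_ev: "additive_family (\<lambda>m c. emb c * (\<Prod>l\<in>#m. e l))"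
  by (simp add: additive_family_def emb_zero emb_add algebra_simps)

lemma ev_add: "ev e (p + q) = ev e p + ev e q"
  unfolding ev_def by (rule linear_ext_add[OF additive_ev])

lemma ev_zero [simp]: "ev e 0 = 0"
  unfolding ev_def by (rule linear_ext_zero)

lemma ev_sum: "ev e (\<Sum>i\<in>I. p i) = (\<Sum>i\<in>I. ev e (p i))"
  unfolding ev_def by (rule linear_ext_sum[OF additive_ev])

lemma ev_diff: "ev e (p - q) = ev e p - ev e q"
  using ev_add[of e "p - q" q] by (simp add: algebra_simps)

lemma ev_single: "ev e (single m c) = emb c * (\<Prod>l\<in>#m. e l)"
  unfolding ev_def by (rule linear_ext_single[OF additive_ev])

lemma ev_letter [simp]: "ev e (letter l) = e l"
  by (simp add: ev_single emb_one)

lemma ev_mult: "ev e (p * q) = ev e p * ev e q"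
proof (induction p rule: poly_mapping_add_induct)
  case (add p p')
  then show ?case by (simp add: ev_add algebra_simps)
next
  case (single m a)
  show ?case
  proof (induction q rule: poly_mapping_add_induct)
    case (add q q')
    then show ?case by (simp add: ev_add algebra_simps)
  next
    case (single n b)
    show ?case by (simp add: mult_single ev_single emb_mult)
  qed
qed

lemma ev_one: "ev e 1 = 1"
  using ev_single[of e 0 1] by (simp add: emb_one)

lemma ev_power: "ev e (p ^ n) = ev e p ^ n"
  by (induction n) (simp_all add: ev_one ev_mult)

lemma ev_cong:
  assumes "\<And>l. l \<in> letters p \<Longrightarrow> e l = e' l"
  shows "ev e p = ev e' p"
  unfolding ev_def linear_ext_def
proof (rule sum.cong[OF HOL.refl])
  fix m assume "m \<in> keys p"
  then have "image_mset e m = image_mset e' m"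
    using assms by (intro image_mset_cong) (auto simp: letters_def)
  then show "emb (lookup p m) * (\<Prod>l\<in>#m. e l) = emb (lookup p m) * (\<Prod>l\<in>#m. e' l)"
    by simp
qed

lemma ev_poly: "ev e (poly P x) = poly (map_poly (ev e) P) (ev e x)"
  by (induction P) (simp_all add: map_poly_pCons ev_add ev_mult)

text \<open>
  All letters have independent values, so a point \<open>e\<close> prescribes a tuple of formal power series
  through the values of their derivatives at \<open>0\<close>. In characteristic \<open>0\<close> the condition says that
  this tuple is a solution of the differential equation \<open>p = 0\<close>. For a fixed \<open>e\<close>, the \<open>p\<close>
  that satisfy it form a differential ideal.
\<close>

definition vanishing :: "('v \<times> nat \<Rightarrow> 'c) \<Rightarrow> ('v, 'k) dpoly \<Rightarrow> bool" where
  "vanishing e p \<longleftrightarrow> (\<forall>j. ev e ((ddt ^^ j) p) = 0)"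

lemma vanishing_ev: "vanishing e p \<Longrightarrow> ev e p = 0"
  unfolding vanishing_def by (metis funpow_0)

lemma vanishing_ddt: "vanishing e p \<Longrightarrow> vanishing e (ddt p)"
  unfolding vanishing_def by (metis funpow_Suc_right comp_apply)

lemma funpow_ddt_add: "(ddt ^^ j) (p + q) = (ddt ^^ j) p + (ddt ^^ j) q"
  by (induction j) (simp_all add: ddt_add)

lemma vanishing_add: "vanishing e p \<Longrightarrow> vanishing e q \<Longrightarrow> vanishing e (p + q)"
  by (simp add: vanishing_def funpow_ddt_add ev_add)

lemma vanishing_mult:
  assumes "vanishing e p"
  shows "vanishing e (p * q)"
proof -
  have "ev e ((ddt ^^ j) (p * q)) = 0" for j
    using assms
  proof (induction j arbitrary: p q)
    case 0
    then show ?case by (simp add: ev_mult vanishing_ev)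
  next
    case (Suc j)
    have "(ddt ^^ Suc j) (p * q) = (ddt ^^ j) (ddt p * q) + (ddt ^^ j) (p * ddt q)"
      by (simp add: funpow_swap1 ddt_mult funpow_ddt_add)
    then show ?case
      using Suc.IH[OF vanishing_ddt[OF Suc.prems], of q] Suc.IH[OF Suc.prems, of "ddt q"]
      by (simp add: ev_add)
  qed
  then show ?thesis by (simp add: vanishing_def)
qed

lemma vanishing_diff:
  assumes "vanishing e p" "vanishing e q"
  shows "vanishing e (p - q)"
proof -
  have "p - q = p + q * (- 1)" by simp
  then show ?thesis using assms by (metis vanishing_add vanishing_mult)
qed

text \<open>
  Differentiating \<open>d\<^sup>n * q\<close> and multiplying by \<open>d\<close> leaves \<open>d\<^sup>n\<^sup>+\<^sup>1 * q'\<close> modulo multiples of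
  \<open>d\<^sup>n * q\<close>. By induction on \<open>j\<close>, the product of a power of \<open>d\<close> with the \<open>j\<close>-th derivative
  of \<open>p\<close> belongs to the ideal, and the value of \<open>d\<close> can be cancelled.
\<close>

lemma vanishing_cancel:
  fixes d p :: "('v, 'k) dpoly"
  assumes "vanishing e (d * p)" "ev e d \<noteq> 0"
  shows "vanishing e p"
proof -
  have step: "vanishing e (d ^ Suc j * (ddt ^^ j) p)" for j
  proof (induction j)
    case 0
    then show ?case using assms(1) by simp
  next
    case (Suc j)
    let ?p = "(ddt ^^ j) p"
    obtain r where r: "ddt (d ^ Suc j) * d = r * d ^ Suc j"
    proof -
      have "\<exists>r. ddt (d ^ n) * d = r * d ^ n" for n
      proof (induction n)
        case 0
        have "ddt (1 :: ('v, 'k) dpoly) = 0" using ddt_const[of 1] by simp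
        then show ?case by (intro exI[of _ 0]) simp
      next
        case (Suc n)
        then obtain r where r: "ddt (d ^ n) * d = r * d ^ n" by blast
        have "ddt (d ^ Suc n) * d = ddt d * d ^ Suc n + d * (ddt (d ^ n) * d)"
          by (simp add: ddt_mult algebra_simps)
        also have "\<dots> = (ddt d + r) * d ^ Suc n"
          unfolding r by (simp add: algebra_simps)
        finally show ?case by blast
      qed
      then show ?thesis using that by blast
    qed
    have "d ^ Suc (Suc j) * (ddt ^^ Suc j) p
        = ddt (d ^ Suc j * ?p) * d - (ddt (d ^ Suc j) * d) * ?p"
      by (simp add: ddt_mult algebra_simps)
    also have "\<dots> = ddt (d ^ Suc j * ?p) * d - (d ^ Suc j * ?p) * r"
      unfolding r by (simp add: algebra_simps)
    finally show ?case
      using vanishing_diff[OF vanishing_mult[OF vanishing_ddt[OF Suc.IH]] vanishing_mult[OF Suc.IH]]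
      by simp
  qed
  have "ev e ((ddt ^^ j) p) = 0" for j
  proof -
    have "ev e d ^ Suc j * ev e ((ddt ^^ j) p) = 0"
      using vanishing_ev[OF step[of j]] by (simp only: ev_mult ev_power)
    then show ?thesis using assms(2) by simp
  qed
  then show ?thesis by (simp add: vanishing_def)
qed

end

text \<open>
  The usual derivative of a univariate polynomial, over coefficient rings that may have zero divisors.
\<close>

definition formal_deriv :: "'r::comm_semiring_1 poly \<Rightarrow> 'r poly" where
  "formal_deriv P = (\<Sum>i<degree P. Polynomial.monom (of_nat (Suc i) * coeff P (Suc i)) i)"

lemma coeff_formal_deriv: "coeff (formal_deriv P) n = of_nat (Suc n) * coeff P (Suc n)"
proof -
  have "coeff (formal_deriv P) n = (\<Sum>i<degree P. if i = n then of_nat (Suc i) * coeff P (Suc i) else 0)"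
    unfolding formal_deriv_def coeff_sum by (intro sum.cong) (simp_all add: coeff_monom)
  then show ?thesis by (cases "n < degree P") (simp_all add: coeff_eq_0)
qed

lemma formal_deriv_pCons: "formal_deriv (pCons a P) = P + pCons 0 (formal_deriv P)"
  by (rule poly_eqI) (simp add: coeff_formal_deriv coeff_pCons algebra_simps split: nat.splits)

lemma formal_deriv_0: "formal_deriv 0 = 0"
  by (simp add: formal_deriv_def)

lemma degree_formal_deriv: "degree P > 0 \<Longrightarrow> degree (formal_deriv P) < degree P"
proof -
  assume "degree P > 0"
  moreover have "degree (formal_deriv P) \<le> degree P - 1"
    by (intro degree_le allI impI) (simp add: coeff_formal_deriv coeff_eq_0)
  ultimately show ?thesis by simp
qed

lemma letters_formal_deriv:
  fixes P :: "('v, 'k::comm_ring_1) dpoly poly"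
  assumes "\<And>i. letters (coeff P i) \<subseteq> A"
  shows "letters (coeff (formal_deriv P) i) \<subseteq> A"
proof -
  have "letters (of_nat n :: ('v, 'k) dpoly) = {}" for n
    by (auto simp: letters_def in_keys_iff lookup_of_nat when_def split: if_splits)
  then show ?thesis
    using letters_mult[of "of_nat (Suc i)" "coeff P (Suc i)"] assms[of "Suc i"]
    unfolding coeff_formal_deriv by blast
qed

lemma ddt_poly:
  "ddt (poly P x) = poly (map_poly ddt P) x + poly (formal_deriv P) x * ddt x"
  by (induction P) (simp_all add: map_poly_pCons ddt_add ddt_mult formal_deriv_pCons formal_deriv_0 algebra_simps)

lemma course_of_values:
  fixes G :: "nat \<Rightarrow> (nat \<Rightarrow> 'c) \<Rightarrow> 'c"
  assumes "\<And>j u u'. (\<And>i. i < j \<Longrightarrow> u i = u' i) \<Longrightarrow> G j u = G j u'"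
  obtains u where "\<And>j. u j = G j u"
proof -
  define u where "u = wfrec less_than (\<lambda>f j. G j f)"
  have "adm_wf less_than (\<lambda>f j. G j f)"
    unfolding adm_wf_def by (intro allI impI assms) simp
  from wfrec_fixpoint[OF wf_less_than this] have "u = (\<lambda>j. G j u)"
    unfolding u_def .
  then show ?thesis using that by metis
qed

text \<open>
  The letters that precede the derivative of order \<open>r\<close> of \<open>y\<close>: derivatives of \<open>y\<close> of smaller order and
  all letters of other indeterminates.
\<close>

definition below :: "'v \<Rightarrow> nat \<Rightarrow> ('v \<times> nat) set" where
  "below y r = {l. fst l = y \<longrightarrow> snd l < r}"

lemma below_mono: "r \<le> s \<Longrightarrow> below y r \<subseteq> below y s"
  by (auto simp: below_def)

lemma letters_ddt_below: "letters p \<subseteq> below y r \<Longrightarrow> letters (ddt p) \<subseteq> below y (Suc r)"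
  using letters_ddt[of p] unfolding below_def by force

text \<open>
  Every derivative of \<open>P\<close> of order at least one is linear in its highest derivative of \<open>y\<close>, and the
  coefficient is always the same: the separant, which is the partial derivative of \<open>P\<close> with
  respect to its own highest derivative of \<open>y\<close>.
\<close>

lemma ddt_iterate_leading:
  fixes P :: "('v, 'k::comm_ring_1) dpoly poly"
  assumes P: "\<And>i. letters (coeff P i) \<subseteq> below y r"
  obtains T where
    "\<And>j. (ddt ^^ Suc j) (poly P (letter (y, r)))
        = poly (formal_deriv P) (letter (y, r)) * letter (y, Suc (r + j)) + T j"
    "\<And>j. letters (T j) \<subseteq> below y (Suc (r + j))"
proof -
  let ?X = "letter (y, r) :: ('v, 'k) dpoly" and ?S = "poly (formal_deriv P) (letter (y, r))"
  have X: "letters (letter (y, i) :: ('v, 'k) dpoly) \<subseteq> below y (Suc i)" for i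
    using letters_single[of "{#(y, i)#}" "1::'k"] by (auto simp: below_def)
  have "letters (coeff (formal_deriv P) i) \<subseteq> below y r" for i
    by (rule letters_formal_deriv[OF P])
  then have S: "letters ?S \<subseteq> below y (Suc r)"
    using X[of r] below_mono[of r "Suc r" y] by (intro letters_poly) auto
  have "\<exists>T. (ddt ^^ Suc j) (poly P ?X) = ?S * letter (y, Suc (r + j)) + T
      \<and> letters T \<subseteq> below y (Suc (r + j))" for j
  proof (induction j)
    case 0
    have "letters (coeff (map_poly ddt P) i) \<subseteq> below y (Suc r)" for i
      using letters_ddt_below[OF P[of i]] by (simp add: coeff_map_poly)
    then have "letters (poly (map_poly ddt P) ?X) \<subseteq> below y (Suc r)"
      using X[of r] by (intro letters_poly) auto
    then show ?case
      by (intro exI[of _ "poly (map_poly ddt P) ?X"]) (simp add: ddt_poly ddt_letter algebra_simps)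
  next
    case (Suc j)
    then obtain T where T: "(ddt ^^ Suc j) (poly P ?X) = ?S * letter (y, Suc (r + j)) + T"
      "letters T \<subseteq> below y (Suc (r + j))" by blast
    have 1: "letters (ddt ?S * letter (y, Suc (r + j))) \<subseteq> below y (Suc (Suc (r + j)))"
      using letters_mult[of "ddt ?S" "letter (y, Suc (r + j))"] letters_ddt_below[OF S]
        X[of "Suc (r + j)"] below_mono[of "Suc (Suc r)" "Suc (Suc (r + j))" y] by auto
    have "letters (ddt ?S * letter (y, Suc (r + j)) + ddt T) \<subseteq> below y (Suc (Suc (r + j)))"
      using letters_add[of "ddt ?S * letter (y, Suc (r + j))" "ddt T"] 1 letters_ddt_below[OF T(2)]
      by auto
    moreover have "(ddt ^^ Suc (Suc j)) (poly P ?X)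
        = ?S * letter (y, Suc (r + Suc j)) + (ddt ?S * letter (y, Suc (r + j)) + ddt T)"
      unfolding funpow.simps comp_apply T(1)[unfolded funpow.simps comp_apply]
      by (simp add: ddt_add ddt_mult ddt_letter algebra_simps)
    ultimately show ?case by (intro exI[of _ "ddt ?S * letter (y, Suc (r + j)) + ddt T"]) simp
  qed
  then show ?thesis using that by metis
qed

context coefficient_field
begin

text \<open>
  Where the separant does not vanish, each further derivative of the equation determines the value of
  the next derivative of \<open>y\<close>.
\<close>

lemma solve_differential_equation:
  fixes P :: "('v, 'k) dpoly poly"
  assumes P: "\<And>i. letters (coeff P i) \<subseteq> below y r"
    and root: "ev e (poly P (letter (y, r))) = 0"
    and separant: "ev e (poly (formal_deriv P) (letter (y, r))) \<noteq> 0"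
  obtains e' where "vanishing e' (poly P (letter (y, r)))" "\<And>l. l \<in> below y (Suc r) \<Longrightarrow> e' l = e l"
proof -
  let ?X = "letter (y, r) :: ('v, 'k) dpoly" and ?S = "poly (formal_deriv P) (letter (y, r))"
  obtain T where T: "\<And>j. (ddt ^^ Suc j) (poly P ?X) = ?S * letter (y, Suc (r + j)) + T j"
    and lT: "\<And>j. letters (T j) \<subseteq> below y (Suc (r + j))"
    using ddt_iterate_leading[OF P] by blast
  define E where "E u = (\<lambda>l. if l \<in> below y (Suc r) then e l else u (snd l))" for u
  \<comment> \<open>solves the derivative of order \<open>j - r\<close> of the equation for the \<open>j\<close>-th derivative of \<open>y\<close>\<close>
  define G where "G j u = - ev (E u) (T (j - Suc r)) / ev e ?S" for j u
  have "\<exists>u. \<forall>j. u j = (if j \<le> r then 0 else G j u)"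
  proof -
    have cong: "(if j \<le> r then 0 else G j u) = (if j \<le> r then 0 else G j u')"
      if "\<And>i. i < j \<Longrightarrow> u i = u' i" for j u u'
    proof (cases "j \<le> r")
      case False
      have "ev (E u) (T (j - Suc r)) = ev (E u') (T (j - Suc r))"
      proof (rule ev_cong)
        fix l assume "l \<in> letters (T (j - Suc r))"
        with lT[of "j - Suc r"] False have "l \<in> below y j" by auto
        then show "E u l = E u' l" using that by (auto simp: E_def below_def)
      qed
      then show ?thesis by (simp add: G_def)
    qed simp
    obtain u where "\<And>j. u j = (if j \<le> r then 0 else G j u)"
      by (rule course_of_values[of "\<lambda>j u. if j \<le> r then 0 else G j u", OF cong]) auto
    then show ?thesis by blast
  qed
  then obtain u where u: "\<And>j. j > r \<Longrightarrow> u j = G j u" by (metis leD)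
  have agree: "E u l = e l" if "l \<in> below y (Suc r)" for l
    using that by (simp add: E_def)
  have eval: "ev (E u) (poly Q ?X) = ev e (poly Q ?X)" if "\<And>i. letters (coeff Q i) \<subseteq> below y r" for Q
  proof (rule ev_cong)
    have "letters (poly Q ?X) \<subseteq> below y (Suc r)"
      by (rule letters_poly) (use that below_mono[of r "Suc r" y] letters_single[of "{#(y, r)#}" "1::'k"]
          in \<open>auto simp: below_def\<close>)
    then show "l \<in> letters (poly Q ?X) \<Longrightarrow> E u l = e l" for l using agree by blast
  qed
  have "letters (coeff (formal_deriv P) i) \<subseteq> below y r" for i
    by (rule letters_formal_deriv[OF P])
  note S = eval[OF this]
  have "ev (E u) ((ddt ^^ j) (poly P ?X)) = 0" for j
  proof (cases j)
    case 0
    then show ?thesis using eval[OF P] root by simp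
  next
    case (Suc i)
    have "E u (y, Suc (r + i)) = G (Suc (r + i)) u"
      using u[of "Suc (r + i)"] by (simp add: E_def below_def)
    then have "ev e ?S * E u (y, Suc (r + i)) = - ev (E u) (T i)"
      using separant by (simp add: G_def)
    then show ?thesis
      unfolding Suc T by (simp add: ev_add ev_mult S)
  qed
  then show ?thesis using that[of "E u"] agree by (simp add: vanishing_def)
qed

text \<open>
  Division with remainder by a polynomial \<open>P\<close> of minimal degree with root \<open>\<alpha>\<close>. The coefficients form
  a ring, so each step multiplies the dividend by the leading coefficient of \<open>P\<close>. By
  minimality no nonzero remainder is left, since it would have smaller degree and the root \<open>\<alpha>\<close>.
\<close>

lemma pseudo_multiple:
  fixes P Q :: "('v, 'k) dpoly poly"
  assumes generic: "\<And>p. ev e p = 0 \<Longrightarrow> p = 0"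
    and P: "P \<noteq> 0" "\<And>i. letters (coeff P i) \<subseteq> A" "poly (map_poly (ev e) P) \<alpha> = 0"
    and minimal: "\<And>Q. Q \<noteq> 0 \<Longrightarrow> (\<And>i. letters (coeff Q i) \<subseteq> A) \<Longrightarrow> poly (map_poly (ev e) Q) \<alpha> = 0
      \<Longrightarrow> degree P \<le> degree Q"
    and Q: "\<And>i. letters (coeff Q i) \<subseteq> A" "poly (map_poly (ev e) Q) \<alpha> = 0"
  shows "\<exists>d R. d \<noteq> 0 \<and> letters d \<subseteq> A \<and> Polynomial.smult d Q = P * R"
  using Q
proof (induction "if Q = 0 then 0 else Suc (degree Q)" arbitrary: Q rule: less_induct)
  case less
  show ?case
  proof (cases "Q = 0")
    case True
    have "ev e 1 \<noteq> 0" by (simp add: ev_one)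
    then have "(1 :: ('v, 'k) dpoly) \<noteq> 0" by (metis ev_zero)
    with True show ?thesis by (intro exI[of _ 1] exI[of _ 0]) (simp add: letters_def)
  next
    case False
    let ?a = "lead_coeff P" and ?b = "lead_coeff Q" and ?k = "degree Q - degree P"
    have le: "degree P \<le> degree Q" using minimal[OF False less.prems] .
    \<comment> \<open>cancels the leading term of \<open>Q\<close>\<close>
    define Q1 where "Q1 = Polynomial.smult ?a Q - Polynomial.monom ?b ?k * P"
    have coeff_Q1: "coeff Q1 i = ?a * coeff Q i - (if i < ?k then 0 else ?b * coeff P (i - ?k))" for i
      by (simp add: Q1_def coeff_monom_mult)
    have letters_Q1: "letters (coeff Q1 i) \<subseteq> A" for i
      unfolding coeff_Q1
      using letters_diff[of "?a * coeff Q i" "if i < ?k then 0 else ?b * coeff P (i - ?k)"]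
        letters_mult[of ?a "coeff Q i"] letters_mult[of ?b "coeff P (i - ?k)"]
        P(2) less.prems(1) by (auto split: if_splits) blast+
    have hom: "map_poly (ev e) (U * V) = map_poly (ev e) U * map_poly (ev e) V" for U V
      by (rule poly_eqI) (simp add: coeff_map_poly coeff_mult ev_sum ev_mult)
    have "map_poly (ev e) Q1 = Polynomial.smult (ev e ?a) (map_poly (ev e) Q)
        - map_poly (ev e) (Polynomial.monom ?b ?k) * map_poly (ev e) P"
      unfolding Q1_def hom[symmetric] by (rule poly_eqI) (simp add: coeff_map_poly ev_diff ev_mult)
    then have root: "poly (map_poly (ev e) Q1) \<alpha> = 0"
      using P(3) less.prems(2) by simp
    have "Q1 = 0 \<or> degree Q1 < degree Q"
    proof (cases "degree Q")
      case 0
      have "coeff Q1 i = 0" for i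
        using 0 le by (cases i) (simp_all add: coeff_Q1 coeff_eq_0 mult.commute)
      then show ?thesis by (intro disjI1 poly_eqI) simp
    next
      case (Suc n)
      have "coeff Q1 i = 0" if "i > n" for i
      proof (cases "i = Suc n")
        case True
        then show ?thesis using Suc le by (simp add: coeff_Q1 mult.commute)
      next
        case False
        with that Suc le show ?thesis by (simp add: coeff_Q1 coeff_eq_0)
      qed
      then show ?thesis using Suc degree_le[of n Q1] by auto
    qed
    then have "(if Q1 = 0 then 0 else Suc (degree Q1)) < (if Q = 0 then 0 else Suc (degree Q))"
      using False by auto
    from less.hyps[OF this letters_Q1 root] obtain d R where d: "d \<noteq> 0" "letters d \<subseteq> A"
      and R: "Polynomial.smult d Q1 = P * R" by blast
    have "ev e d * ev e ?a \<noteq> 0" using d(1) P(1) generic by (metis leading_coeff_0_iff mult_eq_0_iff)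
    then have "d * ?a \<noteq> 0" by (metis ev_mult ev_zero)
    moreover have "letters (d * ?a) \<subseteq> A" using letters_mult[of d ?a] d(2) P(2) by blast
    moreover have "Polynomial.smult (d * ?a) Q = P * (R + Polynomial.smult d (Polynomial.monom ?b ?k))"
    proof -
      have "Polynomial.smult (d * ?a) Q = Polynomial.smult d Q1 + Polynomial.smult d (Polynomial.monom ?b ?k * P)"
        by (simp add: Q1_def smult_diff_right)
      then show ?thesis unfolding R by (simp add: algebra_simps)
    qed
    ultimately show ?thesis by blast
  qed
qed

end

text \<open>
  A differential equation that involves \<open>y\<close> can be solved for \<open>y\<close> over algebraically independent
  values of all letters of the other indeterminates. Minimality of \<open>P\<close> is used twice: the separant
  of \<open>P\<close> has smaller degree, hence does not vanish at \<open>\<alpha>\<close>, and \<open>P\<close> divides a multiple of \<open>F\<close>.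
  If \<open>F\<close> itself had been used in place of \<open>P\<close>, the separant might vanish, as for a square.
\<close>

theorem generic_zero:
  fixes emb :: "'k::{comm_ring_1, ring_char_0} \<Rightarrow> 'c::alg_closed_field" and F :: "('v, 'k) dpoly"
  assumes "coefficient_field emb"
    and generic: "\<And>p :: ('v, 'k) dpoly. coefficient_field.ev emb e p = 0 \<Longrightarrow> p = 0"
    and F: "(y, i) \<in> letters F"
  obtains e' where "coefficient_field.vanishing emb e' F" "\<And>v k. v \<noteq> y \<Longrightarrow> e' (v, k) = e (v, k)"
proof -
  interpret coefficient_field emb by fact
  have finite: "finite (letters F)" by (simp add: letters_def)
  define I where "I = {i. (y, i) \<in> letters F}"
  have "finite I" unfolding I_def using finite_vimageI[OF finite, of "Pair y"]
    by (simp add: vimage_def inj_on_def)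
  \<comment> \<open>the order of \<open>F\<close> in \<open>y\<close>\<close>
  define r where "r = Max I"
  have r: "(y, r) \<in> letters F" using Max_in[OF \<open>finite I\<close>] F by (auto simp: r_def I_def)
  have below: "letters F \<subseteq> below y (Suc r)"
    using Max_ge[OF \<open>finite I\<close>] by (auto simp: below_def r_def I_def less_Suc_eq_le)
  let ?X = "letter (y, r) :: ('v, 'k) dpoly"
  obtain U where U: "F = poly U ?X" and "\<And>i. letters (coeff U i) \<subseteq> letters F - {(y, r)}"
    using collect_letter[of F "(y, r)"] by blast
  then have lU: "letters (coeff U i) \<subseteq> below y r" for i
    using below by (force simp: below_def less_Suc_eq)
  have degree_ev: "degree (map_poly (ev e) Q) = degree Q" for Q :: "('v, 'k) dpoly poly"
    using generic[of "lead_coeff Q"] by (cases "Q = 0") (auto intro: map_poly_degree_eq)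
  have "degree U > 0"
  proof (rule ccontr)
    assume "\<not> degree U > 0"
    then obtain c where "U = [:c:]" by (metis degree_eq_zeroE neq0_conv)
    then have "F = c" "letters c \<subseteq> below y r" using U lU[of 0] by auto
    with r show False by (auto simp: below_def)
  qed
  then obtain \<alpha> where \<alpha>: "poly (map_poly (ev e) U) \<alpha> = 0"
    using alg_closed_imp_poly_has_root[of "map_poly (ev e) U"] by (auto simp: degree_ev)
  define good where "good Q \<longleftrightarrow> Q \<noteq> 0 \<and> (\<forall>i. letters (coeff Q i) \<subseteq> below y r)
      \<and> poly (map_poly (ev e) Q) \<alpha> = 0" for Q :: "('v, 'k) dpoly poly"
  have "good U" using \<open>degree U > 0\<close> lU \<alpha> by (auto simp: good_def)
  then obtain P where "good P" and min: "\<And>Q. good Q \<Longrightarrow> degree P \<le> degree Q"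
    using ex_has_least_nat[of good U degree] by blast
  then have P: "P \<noteq> 0" "\<And>i. letters (coeff P i) \<subseteq> below y r" "poly (map_poly (ev e) P) \<alpha> = 0"
    by (auto simp: good_def)
  have "degree P > 0"
  proof (rule ccontr)
    assume "\<not> degree P > 0"
    then obtain c where "P = [:c:]" by (metis degree_eq_zeroE neq0_conv)
    with P(1,3) show False using generic[of c] by (auto simp: map_poly_pCons)
  qed
  define e1 where "e1 = e((y, r) := \<alpha>)"
  have ev_e1: "ev e1 c = ev e c" if "letters c \<subseteq> below y r" for c :: "('v, 'k) dpoly"
    by (rule ev_cong) (use that in \<open>auto simp: e1_def below_def\<close>)
  have ev_e1_poly: "ev e1 (poly Q ?X) = poly (map_poly (ev e) Q) \<alpha>"
    if "\<And>i. letters (coeff Q i) \<subseteq> below y r" for Q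
  proof -
    have "map_poly (ev e1) Q = map_poly (ev e) Q"
      by (rule poly_eqI) (simp add: coeff_map_poly ev_e1[OF that])
    then show ?thesis by (simp add: ev_poly e1_def)
  qed
  have separant: "ev e1 (poly (formal_deriv P) ?X) \<noteq> 0"
  proof
    have l: "letters (coeff (formal_deriv P) i) \<subseteq> below y r" for i
      by (rule letters_formal_deriv[OF P(2)])
    assume "ev e1 (poly (formal_deriv P) ?X) = 0"
    with l have "poly (map_poly (ev e) (formal_deriv P)) \<alpha> = 0" by (simp add: ev_e1_poly)
    moreover have "formal_deriv P \<noteq> 0"
    proof
      assume "formal_deriv P = 0"
      then have "of_nat (degree P) * lead_coeff P = 0"
        using coeff_formal_deriv[of P "degree P - 1"] \<open>degree P > 0\<close> by (simp del: of_nat_Suc)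
      then have "ev e (of_nat (degree P)) = 0 \<or> ev e (lead_coeff P) = 0"
        by (metis ev_mult ev_zero mult_eq_0_iff)
      then show False using generic \<open>degree P > 0\<close> P(1) by fastforce
    qed
    ultimately have "good (formal_deriv P)" using l by (simp add: good_def)
    with min degree_formal_deriv[OF \<open>degree P > 0\<close>] show False by fastforce
  qed
  obtain e' where e': "vanishing e' (poly P ?X)" "\<And>l. l \<in> below y (Suc r) \<Longrightarrow> e' l = e1 l"
    by (rule solve_differential_equation[OF P(2) _ separant]) (use P in \<open>auto simp: ev_e1_poly\<close>)
  obtain d R where d: "d \<noteq> 0" "letters d \<subseteq> below y r" and R: "Polynomial.smult d U = P * R"
    using pseudo_multiple[OF generic P, of U] min lU \<alpha> by (auto simp: good_def)
  \<comment> \<open>\<open>P\<close> vanishes at \<open>e'\<close> with all derivatives, hence so does \<open>d * F\<close>, and the factor \<open>d\<close> cancels\<close>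
  have "d * F = poly P ?X * poly R ?X"
    using arg_cong[OF R, of "\<lambda>Q. poly Q ?X"] by (simp add: U)
  then have "vanishing e' (d * F)" using vanishing_mult[OF e'(1)] by simp
  moreover have "ev e' d = ev e d"
    by (rule ev_cong) (use d(2) e'(2) in \<open>force simp: below_def e1_def\<close>)
  then have "ev e' d \<noteq> 0" using generic d(1) by metis
  ultimately have "vanishing e' F" by (rule vanishing_cancel)
  moreover have "e' (v, k) = e (v, k)" if "v \<noteq> y" for v k
    using e'(2)[of "(v, k)"] that by (simp add: below_def e1_def)
  ultimately show ?thesis by (rule that)
qed

section \<open>The Freiheitssatz\<close>

text \<open>
  The letters are sent to the indeterminates of a polynomial ring whose field of fractions is then
  closed algebraically. Countability serves to index these indeterminates by natural numbers: the
  linear order makes the polynomial ring an integral domain.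
\<close>

lemma generic_point:
  assumes "countable (UNIV :: 'v set)"
  obtains emb :: "'k::field \<Rightarrow> ((nat \<Rightarrow>\<^sub>0 nat) \<Rightarrow>\<^sub>0 'k) fract alg_closure"
    and e :: "'v \<times> nat \<Rightarrow> ((nat \<Rightarrow>\<^sub>0 nat) \<Rightarrow>\<^sub>0 'k) fract alg_closure"
  where "coefficient_field emb"
    and "\<And>p :: ('v, 'k) dpoly. coefficient_field.ev emb e p = 0 \<Longrightarrow> p = 0"
proof -
  have "countable (UNIV \<times> UNIV :: ('v \<times> nat) set)"
    using assms by (rule countable_SIGMA) simp
  then obtain code :: "'v \<times> nat \<Rightarrow> nat" where "inj code"
    by (auto elim: countableE)
  define mono where "mono m = (\<Sum>l\<in>#m. single (code l) (1 :: nat))" for m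
  have mono_add: "mono (add_mset l m) = single (code l) 1 + mono m" for l m
    by (simp add: mono_def)
  have lookup_mono: "lookup (mono m) (code l) = count m l" for m l
    by (induction m) (auto simp: mono_add mono_def lookup_add lookup_single when_def inj_eq[OF \<open>inj code\<close>])
  have "inj mono"
    by (rule injI, rule multiset_eqI) (metis lookup_mono)
  define emb where "emb c = to_ac (to_fract (single (0 :: nat \<Rightarrow>\<^sub>0 nat) c))" for c :: 'k
  define e where "e l = to_ac (to_fract (single (single (code l) (1 :: nat)) (1 :: 'k)))" for l
  interpret coefficient_field emb
    by unfold_locales (simp_all add: emb_def single_add mult_single flip: to_fract_mult to_ac_mult)
  have mono_e: "(\<Prod>l\<in>#m. e l) = to_ac (to_fract (single (mono m) (1 :: 'k)))" for m
  proof (induction m)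
    case empty
    then show ?case by (simp add: mono_def)
  next
    case (add l m)
    have "single (mono (add_mset l m)) (1 :: 'k) = single (single (code l) 1) 1 * single (mono m) 1"
      by (simp add: mono_add mult_single)
    with add show ?case by (simp add: e_def)
  qed
  have "p = 0" if "ev e p = 0" for p :: "('v, 'k) dpoly"
  proof (rule poly_mapping_eqI)
    fix n
    have "ev e p = to_ac (to_fract (\<Sum>m\<in>keys p. single (mono m) (lookup p m)))"
    proof -
      have "ev e p = (\<Sum>m\<in>keys p. to_ac (to_fract (single (mono m) (lookup p m))))"
        unfolding ev_def linear_ext_def mono_e emb_def
        by (simp add: mult_single flip: to_fract_mult to_ac_mult)
      moreover have "(\<Sum>m\<in>K. to_ac (to_fract (f m))) = to_ac (to_fract (\<Sum>m\<in>K. f m))"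
        for f :: "('v \<times> nat) multiset \<Rightarrow> ((nat \<Rightarrow>\<^sub>0 nat) \<Rightarrow>\<^sub>0 'k)" and K
        by (induction K rule: infinite_finite_induct) simp_all
      ultimately show ?thesis by simp
    qed
    with that have "(\<Sum>m\<in>keys p. single (mono m) (lookup p m)) = 0"
      by (simp only: to_ac_eq_0_iff to_fract_eq_0_iff)
    then have "0 = (\<Sum>m\<in>keys p. lookup (single (mono m) (lookup p m)) (mono n))"
      by (metis lookup_sum lookup_zero)
    also have "\<dots> = (\<Sum>m\<in>keys p. if m = n then lookup p m else 0)"
      by (intro sum.cong HOL.refl) (auto simp: lookup_single when_def inj_eq[OF \<open>inj mono\<close>])
    finally show "lookup p n = lookup 0 n" by (auto simp: in_keys_iff split: if_splits)
  qed
  then show ?thesis using that coefficient_field_axioms by blast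
qed

text \<open>
  The set \<open>?J\<close> of the elements that vanish at the generic zero of \<open>f\<close> is an ideal because the product
  becomes \<open>p' * q\<close> and the vanishing polynomials are closed under derivation.
\<close>

theorem freiheitssatz:
  fixes f :: "('v, 'k::field_char_0) free_novikov"
  assumes countable: "countable (UNIV :: 'v set)"
    and f: "f \<notin> free_novikov.generated_subalgebra (nov_var ` (- {y}))"
  shows "free_novikov.generated_ideal {f} \<inter> free_novikov.generated_subalgebra (nov_var ` (- {y})) = {0}"
proof -
  from f obtain i where i: "(y, i) \<in> letters (dpoly_of f)"
    by (auto simp: generated_subalgebra_iff)
  obtain emb :: "'k \<Rightarrow> ((nat \<Rightarrow>\<^sub>0 nat) \<Rightarrow>\<^sub>0 'k) fract alg_closure" and e :: "'v \<times> nat \<Rightarrow> _"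
    where emb: "coefficient_field emb"
      and generic: "\<And>p :: ('v, 'k) dpoly. coefficient_field.ev emb e p = 0 \<Longrightarrow> p = 0"
    using generic_point[OF countable] by metis
  interpret coefficient_field emb by (rule emb)
  obtain e' where e': "vanishing e' (dpoly_of f)" "\<And>v k. v \<noteq> y \<Longrightarrow> e' (v, k) = e (v, k)"
    using generic_zero[OF emb generic i] by metis
  let ?J = "{a. vanishing e' (dpoly_of a)}"
  have vanishing_mult': "vanishing e' q \<Longrightarrow> vanishing e' (p * q)" for p q :: "('v, 'k) dpoly"
    using vanishing_mult[of e' q p] by (simp add: mult.commute)
  have "vanishing e' 0"
    using vanishing_mult[OF e'(1), of 0] by simp
  then have ideal: "free_novikov.two_sided_ideal ?J"
    unfolding free_novikov.two_sided_ideal_def free_novikov.subspace_def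
    by (auto simp: dpoly_of_zero dpoly_of_add dpoly_of_scale dpoly_of_mult vanishing_add vanishing_mult'
        intro: vanishing_mult vanishing_ddt)
  have sub: "free_novikov.generated_ideal {f} \<subseteq> ?J"
    unfolding free_novikov.generated_ideal_def by (rule hull_minimal) (use ideal e'(1) in auto)
  have "a = 0" if "a \<in> free_novikov.generated_ideal {f}"
    "a \<in> free_novikov.generated_subalgebra (nov_var ` (- {y}))" for a
  proof -
    have "ev e (dpoly_of a) = ev e' (dpoly_of a)"
    proof (rule ev_cong)
      fix l assume "l \<in> letters (dpoly_of a)"
      with that(2) have "fst l \<noteq> y" by (auto simp: generated_subalgebra_iff)
      then show "e l = e' l" using e'(2)[of "fst l" "snd l"] by simp
    qed
    also have "\<dots> = 0" using sub that(1) vanishing_ev by blast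
    finally have "dpoly_of a = dpoly_of 0" using generic by (simp add: dpoly_of_zero)
    then show "a = 0" by (metis value_dpoly_of)
  qed
  moreover have "0 \<in> free_novikov.generated_subalgebra (nov_var ` (- {y}))"
    by (simp add: generated_subalgebra_iff dpoly_of_zero)
  moreover have "0 \<in> free_novikov.generated_ideal {f}"
    unfolding free_novikov.generated_ideal_def hull_def
    by (auto simp: free_novikov.two_sided_ideal_def free_novikov.subspace_0)
  ultimately show ?thesis by blast
qed

theorem theorem2:
  fixes n :: nat
    and x :: "nat \<Rightarrow> 'v"
    and f :: "('v, 'k::field_char_0) free_novikov"
  assumes "bij_betw x {1..n} UNIV"
    and "f \<notin> free_novikov.generated_subalgebra ((\<lambda>i. nov_var (x i)) ` {1..n-1})"
  shows "free_novikov.generated_ideal {f} \<inter>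
         free_novikov.generated_subalgebra ((\<lambda>i. nov_var (x i)) ` {1..n-1}) = {0}"
proof -
  have "n \<noteq> 0"
  proof
    assume "n = 0"
    with assms(1) have "(UNIV :: 'v set) = {}" by (simp add: bij_betw_def)
    then show False by simp
  qed
  have "{1..n-1} = {1..n} - {n}" using \<open>n \<noteq> 0\<close> by auto
  then have "x ` {1..n-1} = x ` {1..n} - x ` {n}"
    using assms(1) inj_on_image_set_diff[of x "{1..n}" "{1..n}" "{n}"] \<open>n \<noteq> 0\<close>
    by (simp add: bij_betw_def)
  then have "x ` {1..n-1} = - {x n}"
    using assms(1) by (auto simp: bij_betw_def)
  then have eq: "(\<lambda>i. nov_var (x i)) ` {1..n-1} = nov_var ` (- {x n})"
    by (metis image_image)
  have "countable (UNIV :: 'v set)"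
    using assms(1) bij_betw_finite countable_finite by blast
  from freiheitssatz[OF this] assms(2) show ?thesis unfolding eq .
qed

end
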